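(* Let $\alpha\in(0,1)$, $\beta>0$, $a<b$, and $L(t,x,v,w,z)$, $l(t,x,v,w)$ real $C^1$ functions. For $x\in\mathcal F([a,b];\mathbb R)$ let $\{x\}(t)=(t,x(t),{^C_aD_t^\alpha}x(t),{_aI_t^\beta}x(t))$, $z(t)=\int_a^t l\{x\}(\tau)d\tau$, $[x](t)=(t,x(t),{^C_aD_t^\alpha}x(t),{_aI_t^\beta}x(t),z(t))$ and $J[x]=\int_a^b L[x](t)dt$. Let $x\in\mathcal F([a,b];\mathbb R)$ satisfy, for all $t\in[a,b]$, \begin{multline*} \frac{\partial L}{\partial x}[x](t)+{_tD^\alpha_b}\left(\frac{\partial L}{\partial v}[x](t)\right)+{_tI_b^\beta}\left(\frac{\partial L}{\partial w}[x](t)\right)+\int_t^b\frac{\partial L}{\partial z}[x](\tau)d\tau\cdot\frac{\partial l}{\partial x}\{x\}(t)\\ +{_tD^\alpha_b}\left(\int_t^b\frac{\partial L}{\partial z}[x](\tau)d\tau\cdot\frac{\partial l}{\partial v}\{x\}(t)\right)+{_tI^\beta_b}\left(\int_t^b\frac{\partial L}{\partial z}[x](\tau)d\tau\cdot\frac{\partial l}{\partial w}\{x\}(t)\right)=0, \end{multline*} and the natural boundary condition \[ \left[{_tI_b^{1-\alpha}}\left(\frac{\partial L}{\partial v}[x](t)+\int_t^b\frac{\partial L}{\partial z}[x](\tau)d\tau\cdot\frac{\partial l}{\partial v}\{x\}(t)\right)\right]_{t=a}=0. \] Assume $L$ is convex in $(x,v,w,z)$. If either (1) $l$ is convex in $(x,v,w)$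 and $\frac{\partial L}{\partial z}[x](t)\ge0$ for all $t\in[a,b]$, or (2) $l$ is concave in $(x,v,w)$ and $\frac{\partial L}{\partial z}[x](t)\le0$ for all $t\in[a,b]$, then $x$ is a global minimizer of $J$ on $\mathcal F([a,b];\mathbb R)$.
   Context: $\mathcal F([a,b];\mathbb R)$: absolutely continuous $x:[a,b]\to\mathbb R$ with ${^C_aD_t^\alpha}x$ and ${_aI_t^\beta}x$ existing and continuous on $[a,b]$. For $\gamma>0$: ${_aI_t^\gamma}x(t)=\frac{1}{\Gamma(\gamma)}\int_a^t(t-\tau)^{\gamma-1}x(\tau)d\tau$, ${_tI_b^\gamma}x(t)=\frac{1}{\Gamma(\gamma)}\int_t^b(\tau-t)^{\gamma-1}x(\tau)d\tau$; ${^C_aD_t^\alpha}x(t)=\frac{1}{\Gamma(1-\alpha)}\int_a^t(t-\tau)^{-\alpha}\dot x(\tau)d\tau$, ${_tD_b^\alpha}x(t)=-\frac{1}{\Gamma(1-\alpha)}\frac{d}{dt}\int_t^b(\tau-t)^{-\alpha}x(\tau)d\tau$. A $C^1$ function $\Psi(t_1,\ldots,t_n)$ is convex (concave) in $(t_k,\ldots,t_n)$ if $\Psi(t_1+\theta_1,\ldots,t_n+\theta_n)-\Psi(t_1,\ldots,t_n)\ge(\le)\sum_{i=k}^n\frac{\partial\Psi}{\partial t_i}(t_1,\ldots,t_n)\theta_i$ for all admissible points. *)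

theory Defs
  imports "HOL-Analysis.Analysis"
begin

definition abs_cont_on :: "real \<Rightarrow> real \<Rightarrow> (real \<Rightarrow> real) \<Rightarrow> bool" where
  "abs_cont_on a b f \<longleftrightarrow>
     (\<forall>\<epsilon>>0. \<exists>\<delta>>0. \<forall>(n::nat) (u::nat \<Rightarrow> real) (v::nat \<Rightarrow> real).
        (\<forall>k<n. a \<le> u k \<and> u k \<le> v k \<and> v k \<le> b) \<and>
        (\<forall>i j. i < j \<and> j < n \<longrightarrow> v i \<le> u j) \<and>
        (\<Sum>k<n. v k - u k) < \<delta>
        \<longrightarrow> (\<Sum>k<n. \<bar>f (v k) - f (u k)\<bar>) < \<epsilon>)"

definition lRL_int :: "real \<Rightarrow> real \<Rightarrow> (real \<Rightarrow> real) \<Rightarrow> real \<Rightarrow> real" where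
  "lRL_int \<gamma> a x t = (1 / Gamma \<gamma>) * integral {a..t} (\<lambda>\<tau>. (t - \<tau>) powr (\<gamma> - 1) * x \<tau>)"

definition rRL_int :: "real \<Rightarrow> real \<Rightarrow> (real \<Rightarrow> real) \<Rightarrow> real \<Rightarrow> real" where
  "rRL_int \<gamma> b x t = (1 / Gamma \<gamma>) * integral {t..b} (\<lambda>\<tau>. (\<tau> - t) powr (\<gamma> - 1) * x \<tau>)"

definition lCaputo :: "real \<Rightarrow> real \<Rightarrow> real \<Rightarrow> (real \<Rightarrow> real) \<Rightarrow> real \<Rightarrow> real" where
  "lCaputo \<alpha> a b x t = (1 / Gamma (1 - \<alpha>)) *
     integral {a..t} (\<lambda>\<tau>. (t - \<tau>) powr (- \<alpha>) * vector_derivative x (at \<tau> within {a..b}))"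

definition rRL_kernel :: "real \<Rightarrow> real \<Rightarrow> (real \<Rightarrow> real) \<Rightarrow> real \<Rightarrow> real" where
  "rRL_kernel \<alpha> b x s = (1 / Gamma (1 - \<alpha>)) * integral {s..b} (\<lambda>\<tau>. (\<tau> - s) powr (- \<alpha>) * x \<tau>)"

definition rRL_der :: "real \<Rightarrow> real \<Rightarrow> real \<Rightarrow> (real \<Rightarrow> real) \<Rightarrow> real \<Rightarrow> real" where
  "rRL_der \<alpha> a b x t = - vector_derivative (rRL_kernel \<alpha> b x) (at t within {a..b})"

definition FF :: "real \<Rightarrow> real \<Rightarrow> real \<Rightarrow> real \<Rightarrow> (real \<Rightarrow> real) set" where
  "FF \<alpha> \<beta> a b = {x. abs_cont_on a b x \<and>
     (\<forall>t\<in>{a..b}. (\<lambda>\<tau>. (t - \<tau>) powr (- \<alpha>) * vector_derivative x (at \<tau> within {a..b}))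
                     integrable_on {a..t}) \<and>
     (\<forall>t\<in>{a..b}. (\<lambda>\<tau>. (t - \<tau>) powr (\<beta> - 1) * x \<tau>) integrable_on {a..t}) \<and>
     continuous_on {a..b} (lCaputo \<alpha> a b x) \<and>
     continuous_on {a..b} (lRL_int \<beta> a x)}"

definition C1_with_partials5 ::
  "(real \<times> real \<times> real \<times> real \<times> real \<Rightarrow> real) \<Rightarrow>
   (real \<times> real \<times> real \<times> real \<times> real \<Rightarrow> real) \<Rightarrow>
   (real \<times> real \<times> real \<times> real \<times> real \<Rightarrow> real) \<Rightarrow>
   (real \<times> real \<times> real \<times> real \<times> real \<Rightarrow> real) \<Rightarrow>
   (real \<times> real \<times> real \<times> real \<times> real \<Rightarrow> real) \<Rightarrow>
   (real \<times> real \<times> real \<times> real \<times> real \<Rightarrow> real) \<Rightarrow> bool" where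
  "C1_with_partials5 F Ft Fx Fv Fw Fz \<longleftrightarrow>
     (\<forall>p. (F has_derivative
        (\<lambda>(dt, dx, dv, dw, dz). Ft p * dt + Fx p * dx + Fv p * dv + Fw p * dw + Fz p * dz)) (at p)) \<and>
     continuous_on UNIV Ft \<and> continuous_on UNIV Fx \<and> continuous_on UNIV Fv \<and>
     continuous_on UNIV Fw \<and> continuous_on UNIV Fz"

definition C1_with_partials4 ::
  "(real \<times> real \<times> real \<times> real \<Rightarrow> real) \<Rightarrow>
   (real \<times> real \<times> real \<times> real \<Rightarrow> real) \<Rightarrow>
   (real \<times> real \<times> real \<times> real \<Rightarrow> real) \<Rightarrow>
   (real \<times> real \<times> real \<times> real \<Rightarrow> real) \<Rightarrow>
   (real \<times> real \<times> real \<times> real \<Rightarrow> real) \<Rightarrow> bool" where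
  "C1_with_partials4 F Ft Fx Fv Fw \<longleftrightarrow>
     (\<forall>p. (F has_derivative
        (\<lambda>(dt, dx, dv, dw). Ft p * dt + Fx p * dx + Fv p * dv + Fw p * dw)) (at p)) \<and>
     continuous_on UNIV Ft \<and> continuous_on UNIV Fx \<and> continuous_on UNIV Fv \<and>
     continuous_on UNIV Fw"

definition convex_L :: "(real \<times> real \<times> real \<times> real \<times> real \<Rightarrow> real) \<Rightarrow>
   (real \<times> real \<times> real \<times> real \<times> real \<Rightarrow> real) \<Rightarrow>
   (real \<times> real \<times> real \<times> real \<times> real \<Rightarrow> real) \<Rightarrow>
   (real \<times> real \<times> real \<times> real \<times> real \<Rightarrow> real) \<Rightarrow>
   (real \<times> real \<times> real \<times> real \<times> real \<Rightarrow> real) \<Rightarrow> bool" where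
  "convex_L F Fx Fv Fw Fz \<longleftrightarrow> (\<forall>t x v w z \<theta>1 \<theta>2 \<theta>3 \<theta>4.
     F (t, x + \<theta>1, v + \<theta>2, w + \<theta>3, z + \<theta>4) - F (t, x, v, w, z) \<ge>
     Fx (t, x, v, w, z) * \<theta>1 + Fv (t, x, v, w, z) * \<theta>2 + Fw (t, x, v, w, z) * \<theta>3
       + Fz (t, x, v, w, z) * \<theta>4)"

definition convex_l :: "(real \<times> real \<times> real \<times> real \<Rightarrow> real) \<Rightarrow>
   (real \<times> real \<times> real \<times> real \<Rightarrow> real) \<Rightarrow>
   (real \<times> real \<times> real \<times> real \<Rightarrow> real) \<Rightarrow>
   (real \<times> real \<times> real \<times> real \<Rightarrow> real) \<Rightarrow> bool" where
  "convex_l F Fx Fv Fw \<longleftrightarrow> (\<forall>t x v w \<theta>1 \<theta>2 \<theta>3.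
     F (t, x + \<theta>1, v + \<theta>2, w + \<theta>3) - F (t, x, v, w) \<ge>
     Fx (t, x, v, w) * \<theta>1 + Fv (t, x, v, w) * \<theta>2 + Fw (t, x, v, w) * \<theta>3)"

definition concave_l :: "(real \<times> real \<times> real \<times> real \<Rightarrow> real) \<Rightarrow>
   (real \<times> real \<times> real \<times> real \<Rightarrow> real) \<Rightarrow>
   (real \<times> real \<times> real \<times> real \<Rightarrow> real) \<Rightarrow>
   (real \<times> real \<times> real \<times> real \<Rightarrow> real) \<Rightarrow> bool" where
  "concave_l F Fx Fv Fw \<longleftrightarrow> (\<forall>t x v w \<theta>1 \<theta>2 \<theta>3.
     F (t, x + \<theta>1, v + \<theta>2, w + \<theta>3) - F (t, x, v, w) \<le>
     Fx (t, x, v, w) * \<theta>1 + Fv (t, x, v, w) * \<theta>2 + Fw (t, x, v, w) * \<theta>3)"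

definition brace :: "real \<Rightarrow> real \<Rightarrow> real \<Rightarrow> real \<Rightarrow> (real \<Rightarrow> real) \<Rightarrow> real \<Rightarrow>
    real \<times> real \<times> real \<times> real" where
  "brace \<alpha> \<beta> a b x t = (t, x t, lCaputo \<alpha> a b x t, lRL_int \<beta> a x t)"

definition zvar :: "(real \<times> real \<times> real \<times> real \<Rightarrow> real) \<Rightarrow> real \<Rightarrow> real \<Rightarrow> real \<Rightarrow> real \<Rightarrow>
    (real \<Rightarrow> real) \<Rightarrow> real \<Rightarrow> real" where
  "zvar l \<alpha> \<beta> a b x t = integral {a..t} (\<lambda>\<tau>. l (brace \<alpha> \<beta> a b x \<tau>))"

definition bracket :: "(real \<times> real \<times> real \<times> real \<Rightarrow> real) \<Rightarrow> real \<Rightarrow> real \<Rightarrow> real \<Rightarrow> real \<Rightarrow>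
    (real \<Rightarrow> real) \<Rightarrow> real \<Rightarrow> real \<times> real \<times> real \<times> real \<times> real" where
  "bracket l \<alpha> \<beta> a b x t =
     (t, x t, lCaputo \<alpha> a b x t, lRL_int \<beta> a x t, zvar l \<alpha> \<beta> a b x t)"

definition JJ :: "(real \<times> real \<times> real \<times> real \<times> real \<Rightarrow> real) \<Rightarrow>
    (real \<times> real \<times> real \<times> real \<Rightarrow> real) \<Rightarrow> real \<Rightarrow> real \<Rightarrow> real \<Rightarrow> real \<Rightarrow>
    (real \<Rightarrow> real) \<Rightarrow> real" where
  "JJ L l \<alpha> \<beta> a b x = integral {a..b} (\<lambda>t. L (bracket l \<alpha> \<beta> a b x t))"

end

theory Submission
  imports Defs
begin

text \<open>Let \<open>h = y - x\<close>. By convexity, \<open>J[y] - J[x]\<close> is bounded below by the integral of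
  \<open>A h + P (D h) + Q (I h)\<close>, where \<open>D\<close> and \<open>I\<close> are the Caputo derivative and the fractional integral
  and \<open>A, P, Q\<close> are the partial derivatives of \<open>L\<close> plus those of \<open>l\<close> weighted by
  \<open>\<Lambda>(t) = \<integral>\<^sub>t\<^sup>b L\<^sub>z\<close>; the weights arise by swapping the order of integration in the term with
  \<open>z\<close>. Fubini moves the fractional operators from \<open>h\<close> to \<open>P\<close> and \<open>Q\<close>. The Euler-Lagrange equation says
  that \<open>K = \<^sub>tI\<^sub>b\<^sup>1\<^sup>-\<^sup>\<alpha> P\<close> has the bounded derivative \<open>A + \<^sub>tI\<^sub>b\<^sup>\<beta> Q\<close>, and \<open>K\<close> vanishes at \<open>b\<close> trivially and at
  \<open>a\<close> by the natural boundary condition, so integration by parts makes the lower bound zero.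

  The Caputo derivative involves the pointwise derivative of an absolutely continuous function, so one
  needs that it exists almost everywhere, is integrable, and integrates back to the function. Almost
  everywhere differentiability is Lebesgue's theorem for continuous monotone functions, applied to the
  variation function. For \<open>p < q\<close>, two applications of the rising sun lemma cover the points of an open
  set \<open>S\<close> at which one Dini derivative exceeds \<open>q\<close> and an opposite one is below \<open>p\<close> by an open
  subset of measure at most \<open>(p / q) |S|\<close>; iterating shows that these points form a null set.\<close>

section \<open>The rising sun lemma\<close>

definition rising_set :: "(real \<Rightarrow> real) \<Rightarrow> real set \<Rightarrow> real set" where
  "rising_set g S = {x \<in> S. \<exists>y>x. {x..y} \<subseteq> S \<and> g x < g y}"

definition falling_set :: "(real \<Rightarrow> real) \<Rightarrow> real set \<Rightarrow> real set" where
  "falling_set g S = {x \<in> S. \<exists>y<x. {y..x} \<subseteq> S \<and> g x < g y}"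

text \<open>Openness, the sun lemma and the membership criterion for falling sets are all obtained
  from the rising versions through this reflection.\<close>

lemma falling_set_eq_rising_set:
  "falling_set g S = uminus ` rising_set (\<lambda>t. g (- t)) (uminus ` S)"
proof -
  have *: "{x..y} \<subseteq> uminus ` S \<longleftrightarrow> {-y..-x} \<subseteq> S" for x y
  proof -
    have "{x..y} = uminus ` {-y..-x}" by simp
    then show ?thesis
      by (metis inj_image_subset_iff inj_uminus)
  qed
  show ?thesis
  proof (intro equalityI subsetI)
    fix x assume "x \<in> falling_set g S"
    then obtain y where y: "x \<in> S" "y < x" "{y..x} \<subseteq> S" "g x < g y"
      by (auto simp: falling_set_def)
    have "- x \<in> rising_set (\<lambda>t. g (- t)) (uminus ` S)"
      unfolding rising_set_def mem_Collect_eq *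
      using y by (intro conjI exI[of _ "-y"]) auto
    then show "x \<in> uminus ` rising_set (\<lambda>t. g (- t)) (uminus ` S)"
      by (metis image_eqI minus_minus)
  next
    fix x assume "x \<in> uminus ` rising_set (\<lambda>t. g (- t)) (uminus ` S)"
    then have "- x \<in> rising_set (\<lambda>t. g (- t)) (uminus ` S)" by force
    then obtain y where y: "- x \<in> uminus ` S" "y > - x" "{-x..y} \<subseteq> uminus ` S" "g x < g (- y)"
      by (auto simp: rising_set_def)
    then show "x \<in> falling_set g S"
      unfolding falling_set_def mem_Collect_eq
      using *[of "-x" y] by (intro conjI exI[of _ "-y"]) auto
  qed
qed

text \<open>A witness \<open>y\<close> for \<open>x\<close> also serves every point \<open>z\<close>
  near \<open>x\<close>: moving the left end within a ball inside \<open>S\<close> keeps the segment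
  in \<open>S\<close>, and \<open>g z < g y\<close> is an open condition.\<close>

lemma open_rising_set:
  assumes S: "open S" and g: "continuous_on UNIV g"
  shows "open (rising_set g S)"
proof (subst open_subopen, intro ballI)
  fix x assume "x \<in> rising_set g S"
  then obtain y where y: "x \<in> S" "x < y" "{x..y} \<subseteq> S" "g x < g y"
    by (auto simp: rising_set_def)
  obtain e where e: "e > 0" "ball x e \<subseteq> S" using S y(1) open_contains_ball by blast
  let ?T = "ball x e \<inter> {..<y} \<inter> g -` {..<g y}"
  have "open (g -` {..<g y})"
    using g by (auto intro: open_vimage)
  then have "open ?T" by (intro open_Int) auto
  moreover have "?T \<subseteq> rising_set g S"
  proof
    fix z assume z: "z \<in> ?T"
    have "{z..y} \<subseteq> S"
    proof
      fix w assume w: "w \<in> {z..y}"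
      show "w \<in> S"
      proof (cases "w < x")
        case True
        then have "w \<in> ball x e" using z w by (auto simp: dist_real_def)
        then show ?thesis using e by auto
      next
        case False then show ?thesis using y(3) w by auto
      qed
    qed
    then show "z \<in> rising_set g S"
      using z e(2) unfolding rising_set_def by auto
  qed
  ultimately show "\<exists>T. open T \<and> x \<in> T \<and> T \<subseteq> rising_set g S"
    using y e(1) by (intro exI[of _ ?T]) auto
qed

lemma open_falling_set:
  assumes "open S" and "continuous_on UNIV g"
  shows "open (falling_set g S)"
  unfolding falling_set_eq_rising_set
  using assms
  by (intro open_negations open_rising_set continuous_on_compose2[OF assms(2)] continuous_intros) auto

text \<open>Riesz's argument: if \<open>g d < g x\<close>, take the last point \<open>m\<close>
  between \<open>x\<close> and \<open>d\<close> with \<open>g m \<ge> g x\<close>. It lies in the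
  rising set. A witness up to \<open>d\<close> contradicts the choice of \<open>m\<close>, and a
  witness beyond \<open>d\<close> puts \<open>d\<close> itself into the rising set.\<close>

lemma rising_sun:
  assumes g: "continuous_on UNIV g" and "c < d"
    and sub: "{c<..<d} \<subseteq> rising_set g S" and d: "d \<notin> rising_set g S"
  shows "g c \<le> g d"
proof -
  have *: "g x \<le> g d" if x: "c < x" "x < d" for x
  proof (rule ccontr)
    assume "\<not> g x \<le> g d"
    then have less: "g d < g x" by simp
    let ?S = "{x..d} \<inter> g -` {g x..}"
    have "closed (g -` {g x..})" using g by (auto intro: closed_vimage)
    then have "compact ?S" by (intro compact_Int_closed) auto
    moreover have "x \<in> ?S" using x by simp
    then have "?S \<noteq> {}" by blast
    ultimately obtain m where m: "m \<in> ?S" "\<forall>t\<in>?S. t \<le> m"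
      using compact_attains_sup by blast
    have mx: "x \<le> m" "m \<le> d" "g x \<le> g m" using m(1) by simp_all
    then have "m \<noteq> d" using less by auto
    then have "m \<in> {c<..<d}" using mx x by simp
    then have "m \<in> rising_set g S" using sub by blast
    then obtain y where y: "m < y" "{m..y} \<subseteq> S" "g m < g y"
      by (auto simp: rising_set_def)
    show False
    proof (cases "y \<le> d")
      case True
      then have "y \<in> ?S" using y mx by simp
      then show False using m(2) y(1) by (meson not_le)
    next
      case False
      then have "d \<in> S" "{d..y} \<subseteq> S" "g d < g y"
        using y mx less by (auto simp: subset_iff)
      then have "d \<in> rising_set g S"
        unfolding rising_set_def mem_Collect_eq using False by (intro conjI exI[of _ y]) auto
      then show False using d by blast
    qed
  qed
  \<comment> \<open>Only interior points are known to lie in the rising set, so \<open>c\<close> is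
    reached as a right-hand limit.\<close>
  have "isCont g c" using g by (simp add: continuous_on_eq_continuous_at)
  then have "(g \<longlongrightarrow> g c) (at_right c)"
    by (simp add: isCont_def filterlim_at_split)
  moreover have "eventually (\<lambda>x. g x \<le> g d) (at_right c)"
    using eventually_at_right_field \<open>c < d\<close> * by blast
  ultimately show ?thesis
    by (rule tendsto_upperbound) auto
qed

lemma falling_sun:
  assumes g: "continuous_on UNIV g" and "c < d"
    and sub: "{c<..<d} \<subseteq> falling_set g S" and c: "c \<notin> falling_set g S"
  shows "g d \<le> g c"
proof -
  have "g (- (-d)) \<le> g (- (- c))"
  proof (rule rising_sun[where g = "\<lambda>t. g (- t)" and S = "uminus ` S"])
    show "continuous_on UNIV (\<lambda>t. g (- t))"
      by (intro continuous_on_compose2[OF g] continuous_intros) auto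
    have "{-d<..<-c} = uminus ` {c<..<d}" by simp
    also have "\<dots> \<subseteq> uminus ` falling_set g S" using sub by (rule image_mono)
    also have "\<dots> = rising_set (\<lambda>t. g (- t)) (uminus ` S)"
      by (simp add: falling_set_eq_rising_set image_image)
    finally show "{-d<..<-c} \<subseteq> rising_set (\<lambda>t. g (- t)) (uminus ` S)" .
    show "- c \<notin> rising_set (\<lambda>t. g (- t)) (uminus ` S)"
      using c unfolding falling_set_eq_rising_set by force
  qed (use \<open>c < d\<close> in simp)
  then show ?thesis by simp
qed

section \<open>Components of bounded open sets of reals\<close>

lemma open_component_interval:
  fixes U :: "real set"
  assumes U: "open U" "bounded U" and C: "C \<in> components U"
  obtains c d where "c < d" "C = {c<..<d}" "c \<notin> U" "d \<notin> U"
proof -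
  have C': "open C" "connected C" "C \<noteq> {}" "C \<subseteq> U"
    using open_components[OF U(1) C] in_components_connected[OF C]
      in_components_nonempty[OF C] in_components_subset[OF C] by auto
  then have bC: "bounded C" using U bounded_subset by blast
  then have bb: "bdd_above C" "bdd_below C"
    by (auto intro: bounded_imp_bdd_above bounded_imp_bdd_below)
  let ?c = "Inf C" and ?d = "Sup C"
  have C_eq: "C = {?c<..<?d}"
  proof (intro equalityI subsetI)
    fix x assume x: "x \<in> C"
    obtain e where e: "e > 0" "cball x e \<subseteq> C" using C'(1) x open_contains_cball by blast
    have "x - e \<in> cball x e" "x + e \<in> cball x e" using e(1) by (auto simp: dist_real_def)
    then have "x - e \<in> C" "x + e \<in> C" using e(2) by blast+
    then have "?c \<le> x - e" "x + e \<le> ?d" using bb by (auto intro: cInf_lower cSup_upper)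
    then show "x \<in> {?c<..<?d}" using e(1) by auto
  next
    fix x assume x: "x \<in> {?c<..<?d}"
    then obtain u v where "u \<in> C" "u < x" "v \<in> C" "x < v"
      using C'(3) bb cInf_lessD less_cSup_iff by (metis greaterThanLessThan_iff)
    then show "x \<in> C" using C'(2) connected_contains_Icc[of C u v] by auto
  qed
  then have cd: "?c < ?d" using C'(3) by (metis greaterThanLessThan_empty_iff not_le_imp_less)
  \<comment> \<open>An endpoint in \<open>U\<close> could be adjoined to \<open>C\<close>, giving a
    larger connected subset of \<open>U\<close> against the maximality of a component.\<close>
  have out: "e \<notin> U" if e: "e = ?c \<or> e = ?d" for e
  proof
    assume "e \<in> U"
    have "insert e C = {?c..<?d} \<or> insert e C = {?c<..?d}"
      by (subst (1 2) C_eq) (use e cd in fastforce)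
    then have "connected (insert e C)"
      by (metis is_interval_connected is_interval_co is_interval_oc)
    then have "insert e C \<subseteq> C"
      using C \<open>e \<in> U\<close> C'(3,4) by (intro components_maximal[OF C]) auto
    then show False using e C_eq by (metis greaterThanLessThan_iff insert_subset less_irrefl)
  qed
  show ?thesis using that[of ?c ?d] cd C_eq out by blast
qed

text \<open>\<open>U\<close> is the countable disjoint union of its components, so both measures are
  sums over them. The endpoint conditions in \<open>le\<close> supply what the sun lemmas ask
  for.\<close>

lemma emeasure_open_le:
  fixes U :: "real set"
  assumes U: "open U" "bounded U"
    and sets: "sets M = sets borel" "sets N = sets borel"
    and le: "\<And>c d. c < d \<Longrightarrow> {c<..<d} \<subseteq> U \<Longrightarrow> c \<notin> U \<Longrightarrow> d \<notin> U \<Longrightarrow>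
               emeasure M {c<..<d} \<le> emeasure N {c<..<d}"
  shows "emeasure M U \<le> emeasure N U"
proof -
  have op: "open C" if "C \<in> components U" for C
    using open_components[OF U(1) that] .
  have disj: "disjoint_family_on (\<lambda>C. C) (components U)"
    using pairwise_disjoint_components[of U] by (auto simp: disjoint_family_on_def pairwise_def)
  have cnt: "countable (components U)"
    using op pairwise_disjoint_components[of U]
    by (intro countable_disjoint_open_subsets) (auto simp: pairwise_def disjnt_def disjoint_def)
  have eq: "emeasure R U = (\<integral>\<^sup>+C. emeasure R C \<partial>count_space (components U))"
    if "sets R = sets borel" for R
    using emeasure_UN_countable[of "components U" "\<lambda>C. C" R] op disj cnt that by auto
  show ?thesis
    unfolding eq[OF sets(1)] eq[OF sets(2)]
  proof (rule nn_integral_mono)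
    fix C assume "C \<in> space (count_space (components U))"
    then have C: "C \<in> components U" by simp
    obtain c d where "c < d" "C = {c<..<d}" "c \<notin> U" "d \<notin> U"
      using open_component_interval[OF U C] .
    then show "emeasure M C \<le> emeasure N C"
      using le in_components_subset[OF C] by auto
  qed
qed

section \<open>Lebesgue's differentiation theorem for monotone functions\<close>

text \<open>Continuity of \<open>F\<close> makes single points null for the Stieltjes measure, so
  the open interval has the mass of the closed one.\<close>

lemma emeasure_interval_measure_Ioo:
  fixes F :: "real \<Rightarrow> real"
  assumes F: "mono F" "continuous_on UNIV F" and "c < d"
  shows "emeasure (interval_measure F) {c<..<d} = ennreal (F d - F c)"
proof -
  let ?M = "interval_measure F"
  have Icc: "emeasure ?M {x..y} = ennreal (F y - F x)" if "x \<le> y" for x y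
    using emeasure_interval_measure_Icc[of x y F] that F by (auto dest: monoD)
  have "emeasure ?M {c<..<d} = emeasure ?M {c..d}"
  proof (rule emeasure_eq_AE)
    have "{c} \<in> null_sets ?M" "{d} \<in> null_sets ?M"
      using Icc[of c c] Icc[of d d] by (auto intro!: null_setsI)
    then have "{c} \<union> {d} \<in> null_sets ?M" by (rule null_sets.Un)
    then show "AE x in ?M. x \<in> {c<..<d} \<longleftrightarrow> x \<in> {c..d}"
      by (rule AE_I') auto
  qed auto
  then show ?thesis using Icc[of c d] \<open>c < d\<close> by simp
qed

text \<open>On a component with ends \<open>c\<close> and \<open>d\<close> the sun lemma for
  \<open>F t - q * t\<close> gives \<open>q * (d - c) \<le> F d - F c\<close>, which compares length
  with Stieltjes mass; the components are then summed.\<close>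

lemma rising_set_measure:
  fixes F :: "real \<Rightarrow> real"
  assumes F: "mono F" "continuous_on UNIV F" and q: "0 < q" and S: "open S" "bounded S"
  defines "U \<equiv> rising_set (\<lambda>t. F t - q * t) S"
  shows "ennreal q * emeasure lborel U \<le> emeasure (interval_measure F) U"
proof -
  have g: "continuous_on UNIV (\<lambda>t. F t - q * t)" by (intro continuous_intros F)
  have "U \<subseteq> S" by (auto simp: U_def rising_set_def)
  then have U: "open U" "bounded U"
    using open_rising_set[OF S(1) g] S(2) bounded_subset by (auto simp: U_def)
  have "emeasure (scale_measure (ennreal q) lborel) U \<le> emeasure (interval_measure F) U"
  proof (rule emeasure_open_le[OF U])
    fix c d :: real assume "c < d" "{c<..<d} \<subseteq> U" "c \<notin> U" "d \<notin> U"
    then have "F c - q * c \<le> F d - q * d"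
      using rising_sun[OF g] by (simp add: U_def)
    then show "emeasure (scale_measure (ennreal q) lborel) {c<..<d} \<le> emeasure (interval_measure F) {c<..<d}"
      using \<open>c < d\<close> q
      by (simp add: emeasure_interval_measure_Ioo[OF F] ennreal_mult[symmetric] algebra_simps ennreal_leI)
  qed auto
  then show ?thesis by simp
qed

lemma falling_set_measure:
  fixes F :: "real \<Rightarrow> real"
  assumes F: "mono F" "continuous_on UNIV F" and p: "0 < p" and S: "open S" "bounded S"
  defines "U \<equiv> falling_set (\<lambda>t. F t - p * t) S"
  shows "emeasure (interval_measure F) U \<le> ennreal p * emeasure lborel U"
proof -
  have g: "continuous_on UNIV (\<lambda>t. F t - p * t)" by (intro continuous_intros F)
  have "U \<subseteq> S" by (auto simp: U_def falling_set_def)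
  then have U: "open U" "bounded U"
    using open_falling_set[OF S(1) g] S(2) bounded_subset by (auto simp: U_def)
  have "emeasure (interval_measure F) U \<le> emeasure (scale_measure (ennreal p) lborel) U"
  proof (rule emeasure_open_le[OF U])
    fix c d :: real assume "c < d" "{c<..<d} \<subseteq> U" "c \<notin> U" "d \<notin> U"
    then have "F d - p * d \<le> F c - p * c"
      using falling_sun[OF g] by (simp add: U_def)
    then show "emeasure (interval_measure F) {c<..<d} \<le> emeasure (scale_measure (ennreal p) lborel) {c<..<d}"
      using \<open>c < d\<close> p
      by (simp add: emeasure_interval_measure_Ioo[OF F] ennreal_mult[symmetric] algebra_simps ennreal_leI)
  qed auto
  then show ?thesis by simp
qed

lemma mem_rising_set:
  assumes "open S" "x \<in> S" "\<exists>\<^sub>F y in at_right x. g x < g y"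
  shows "x \<in> rising_set g S"
proof -
  obtain e where e: "e > 0" "ball x e \<subseteq> S" using assms open_contains_ball by blast
  \<comment> \<open>The inequality recurs arbitrarily close to \<open>x\<close>, so a witness can be
    taken within \<open>e\<close> of \<open>x\<close>, which keeps the segment inside
    \<open>S\<close>.\<close>
  have "\<forall>\<^sub>F y in at_right x. g x < g y \<longrightarrow> g x < g y \<and> x < y \<and> y < x + e" using e
    by (auto simp: eventually_at_right_field intro!: exI[of _ "x + e"])
  then have "\<exists>\<^sub>F y in at_right x. g x < g y \<and> x < y \<and> y < x + e"
    by (rule frequently_mp[OF _ assms(3)])
  then obtain y where y: "g x < g y" "x < y" "y < x + e" by (auto dest: frequently_ex)
  then have "{x..y} \<subseteq> S" using e by (auto simp: dist_real_def subset_iff)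
  then show ?thesis using assms(2) y by (auto simp: rising_set_def)
qed

lemma mem_falling_set:
  assumes "open S" "x \<in> S" "\<exists>\<^sub>F y in at_left x. g x < g y"
  shows "x \<in> falling_set g S"
proof -
  have "-x \<in> rising_set (\<lambda>t. g (- t)) (uminus ` S)"
  proof (rule mem_rising_set)
    show "\<exists>\<^sub>F y in at_right (- x). g (- (- x)) < g (- y)"
      using assms(3) unfolding at_left_minus[of x] frequently_filtermap by simp
    show "open (uminus ` S)" using assms(1) by (rule open_negations)
    show "- x \<in> uminus ` S" using assms(2) by simp
  qed
  then show ?thesis
    unfolding falling_set_eq_rising_set by (metis image_eqI minus_minus)
qed

text \<open>The Stieltjes mass links the two covers: \<open>q\<close> times the length of
  \<open>T V\<close> is at most the mass of \<open>T V\<close>, which is at most the mass of the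
  falling set, which is at most \<open>p\<close> times the length of \<open>V\<close>. So
  \<open>T\<close> shrinks length by the factor \<open>p / q\<close> and loses no exceptional
  point.\<close>

lemma negligible_Dini_gap:
  fixes F :: "real \<Rightarrow> real"
  assumes F: "mono F" "continuous_on UNIV F" and pq: "0 < p" "p < q"
  shows "negligible {x. (\<exists>\<^sub>F y in at_right x. q * (y - x) < F y - F x) \<and>
                        (\<exists>\<^sub>F y in at_left x. F x - F y < p * (x - y))}" (is "negligible ?E")
proof (subst negligible_on_intervals, intro allI)
  fix a b :: real
  \<comment> \<open>The margin 1 places \<open>cbox a b\<close> inside a bounded open set, where the
    iteration can start.\<close>
  define S where "S = {a - 1<..<b + 1}"
  define gq where "gq = (\<lambda>t. F t - q * t)"
  define gp where "gp = (\<lambda>t. F t - p * t)"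
  define T where "T = (\<lambda>S. rising_set gq (falling_set gp S))"
  have cont: "continuous_on UNIV gq" "continuous_on UNIV gp"
    unfolding gq_def gp_def by (intro continuous_intros F)+
  have sub: "T V \<subseteq> falling_set gp V" "falling_set gp V \<subseteq> V" for V
    by (auto simp: T_def rising_set_def falling_set_def)
  have opT: "open (falling_set gp V)" "open (T V)" if "open V" for V
    unfolding T_def by (intro open_rising_set open_falling_set that cont)+
  have le: "emeasure lborel (T V) \<le> ennreal (p / q) * emeasure lborel V"
    if V: "open V" "bounded V" for V
  proof -
    have bf: "bounded (falling_set gp V)" using bounded_subset[OF V(2) sub(2)] .
    have "ennreal q * emeasure lborel (T V) \<le> emeasure (interval_measure F) (T V)"
      using rising_set_measure[OF F _ opT(1)[OF V(1)] bf, of q] pq by (simp add: T_def gq_def)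
    also have "\<dots> \<le> emeasure (interval_measure F) (falling_set gp V)"
      using sub(1)[of V] opT[OF V(1)] by (intro emeasure_mono) auto
    also have "\<dots> \<le> ennreal p * emeasure lborel (falling_set gp V)"
      using falling_set_measure[OF F pq(1) V] by (simp add: gp_def)
    also have "\<dots> \<le> ennreal p * emeasure lborel V"
      using sub(2)[of V] V(1) by (intro mult_left_mono emeasure_mono) auto
    finally have "ennreal (1 / q) * (ennreal q * emeasure lborel (T V)) \<le>
                  ennreal (1 / q) * (ennreal p * emeasure lborel V)"
      by (intro mult_left_mono) auto
    moreover have "ennreal (1 / q) * ennreal q = 1" "ennreal (1 / q) * ennreal p = ennreal (p / q)"
      using pq ennreal_mult[of "1 / q" q] ennreal_mult[of "1 / q" p] by auto
    ultimately show ?thesis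
      unfolding mult.assoc[symmetric] by simp
  qed
  have S: "open S" "bounded S" by (auto simp: S_def)
  have Tn: "open ((T ^^ n) S) \<and> (T ^^ n) S \<subseteq> S \<and>
            emeasure lborel ((T ^^ n) S) \<le> ennreal ((p / q) ^ n) * emeasure lborel S" for n
  proof (induction n)
    case 0
    then show ?case using S by simp
  next
    case (Suc n)
    then have b: "bounded ((T ^^ n) S)" using S bounded_subset by blast
    have "emeasure lborel ((T ^^ Suc n) S) \<le> ennreal (p / q) * emeasure lborel ((T ^^ n) S)"
      using le Suc b by simp
    also have "\<dots> \<le> ennreal (p / q) * (ennreal ((p / q) ^ n) * emeasure lborel S)"
      using Suc by (intro mult_left_mono) auto
    also have "\<dots> = ennreal ((p / q) ^ Suc n) * emeasure lborel S"
      using pq ennreal_mult[of "p / q" "(p / q) ^ n"] by (simp add: mult.assoc)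
    finally have "emeasure lborel ((T ^^ Suc n) S) \<le> ennreal ((p / q) ^ Suc n) * emeasure lborel S" .
    moreover have "(T ^^ Suc n) S \<subseteq> S"
      using Suc sub[of "(T ^^ n) S"] by (metis comp_apply funpow.simps(2) subset_trans)
    moreover have "open ((T ^^ Suc n) S)"
      using Suc opT(2) by (metis comp_apply funpow.simps(2))
    ultimately show ?case by blast
  qed
  define G where "G = (\<Inter>n. (T ^^ n) S)"
  have G: "G \<in> sets lborel" using Tn by (auto simp: G_def)
  have "emeasure lborel G \<le> ennreal ((p / q) ^ n * measure lborel S)" for n
  proof -
    have "emeasure lborel G \<le> emeasure lborel ((T ^^ n) S)"
      using Tn by (intro emeasure_mono) (auto simp: G_def)
    also have "\<dots> \<le> ennreal ((p / q) ^ n) * emeasure lborel S" using Tn by blast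
    also have "emeasure lborel S = ennreal (measure lborel S)"
      by (cases "a - 1 \<le> b + 1") (auto simp: S_def)
    finally show ?thesis using pq by (simp add: ennreal_mult[symmetric] del: power_divide)
  qed
  moreover have "(\<lambda>n. ennreal ((p / q) ^ n * measure lborel S)) \<longlonglongrightarrow> ennreal (0 * measure lborel S)"
    using pq by (intro tendsto_ennrealI tendsto_mult LIMSEQ_power_zero tendsto_const) auto
  ultimately have "emeasure lborel G \<le> 0"
    by (intro LIMSEQ_le_const) auto
  then have "negligible G"
    using G by (simp add: negligible_iff_null_sets null_sets_completionI null_sets_def)
  moreover have "?E \<inter> cbox a b \<subseteq> G"
  proof
    fix x assume x: "x \<in> ?E \<inter> cbox a b"
    have fr: "\<exists>\<^sub>F y in at_right x. gq x < gq y" "\<exists>\<^sub>F y in at_left x. gp x < gp y"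
    proof -
      have "gq x < gq y \<longleftrightarrow> q * (y - x) < F y - F x" "gp x < gp y \<longleftrightarrow> F x - F y < p * (x - y)" for y
        by (auto simp: gq_def gp_def algebra_simps)
      then show "\<exists>\<^sub>F y in at_right x. gq x < gq y" "\<exists>\<^sub>F y in at_left x. gp x < gp y"
        using x by auto
    qed
    \<comment> \<open>Both frequency conditions are local and both stages of \<open>T\<close>
      produce open sets, so membership survives every application of \<open>T\<close>.\<close>
    have "x \<in> (T ^^ n) S" for n
    proof (induction n)
      case 0
      then show ?case using x by (auto simp: S_def)
    next
      case (Suc n)
      then show ?case
        using mem_rising_set[OF opT(1) mem_falling_set[OF _ Suc fr(2)] fr(1)] Tn[of n]
        by (simp add: T_def)
    qed
    then show "x \<in> G" by (auto simp: G_def)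
  qed
  ultimately show "negligible (?E \<inter> cbox a b)" by (rule negligible_subset)
qed

text \<open>Such points in the given interval lie in every \<open>U n\<close>. By
  \<open>rising_set_measure\<close>, \<open>n + 1\<close> times the length of \<open>U n\<close> is
  at most the finite Stieltjes mass \<open>m\<close> of \<open>S\<close>, so these lengths tend to
  zero.\<close>

lemma negligible_Dini_infinite:
  fixes F :: "real \<Rightarrow> real"
  assumes F: "mono F" "continuous_on UNIV F"
  shows "negligible {x. \<forall>n. \<exists>\<^sub>F y in at_right x. real (Suc n) * (y - x) < F y - F x}" (is "negligible ?E")
proof (subst negligible_on_intervals, intro allI)
  fix a b :: real
  define S where "S = {a - 1<..<b + 1}"
  define U where "U = (\<lambda>n. rising_set (\<lambda>t. F t - real (Suc n) * t) S)"
  define m where "m = measure (interval_measure F) S"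
  have S: "open S" "bounded S" by (auto simp: S_def)
  have U: "open (U n)" "U n \<subseteq> S" for n
  proof -
    show "open (U n)"
      unfolding U_def by (intro open_rising_set S continuous_intros F)
    show "U n \<subseteq> S" unfolding U_def rising_set_def by blast
  qed
  have "emeasure (interval_measure F) S < \<infinity>"
    by (cases "a - 1 < b + 1") (auto simp: S_def emeasure_interval_measure_Ioo[OF F])
  then have mS: "emeasure (interval_measure F) S = ennreal m"
    by (simp add: m_def emeasure_eq_ennreal_measure)
  define G where "G = (\<Inter>n. U n)"
  have G: "G \<in> sets lborel" using U by (auto simp: G_def)
  have "emeasure lborel G \<le> ennreal (inverse (real (Suc n)) * m)" for n
  proof -
    have "ennreal (real (Suc n)) * emeasure lborel G \<le> ennreal (real (Suc n)) * emeasure lborel (U n)"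
      using U by (intro mult_left_mono emeasure_mono) (auto simp: G_def)
    also have "\<dots> \<le> emeasure (interval_measure F) (U n)"
      unfolding U_def by (rule rising_set_measure[OF F _ S]) simp
    also have "\<dots> \<le> emeasure (interval_measure F) S"
      using U S by (intro emeasure_mono) auto
    finally have "ennreal (inverse (real (Suc n))) * (ennreal (real (Suc n)) * emeasure lborel G) \<le>
        ennreal (inverse (real (Suc n))) * ennreal m"
      unfolding mS by (intro mult_left_mono) auto
    moreover have "inverse (real (Suc n)) * real (Suc n) = 1" by simp
    ultimately show ?thesis
      by (simp add: mult.assoc[symmetric] ennreal_mult[symmetric] m_def del: of_nat_Suc)
  qed
  moreover have "(\<lambda>n. ennreal (inverse (real (Suc n)) * m)) \<longlonglongrightarrow> ennreal (0 * m)"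
    by (intro tendsto_ennrealI tendsto_mult LIMSEQ_inverse_real_of_nat tendsto_const)
  ultimately have "emeasure lborel G \<le> 0"
    by (intro LIMSEQ_le_const) auto
  then have "negligible G"
    using G by (simp add: negligible_iff_null_sets null_sets_completionI null_sets_def)
  moreover have "?E \<inter> cbox a b \<subseteq> G"
  proof
    fix x assume x: "x \<in> ?E \<inter> cbox a b"
    have "x \<in> U n" for n
      unfolding U_def
    proof (rule mem_rising_set[OF S(1)])
      have "F x - real (Suc n) * x < F y - real (Suc n) * y \<longleftrightarrow> real (Suc n) * (y - x) < F y - F x" for y
        by (auto simp: algebra_simps)
      moreover have "\<exists>\<^sub>F y in at_right x. real (Suc n) * (y - x) < F y - F x" using x by blast
      ultimately show "\<exists>\<^sub>F y in at_right x. F x - real (Suc n) * x < F y - real (Suc n) * y"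
        by presburger
    qed (use x in \<open>auto simp: S_def\<close>)
    then show "x \<in> G" by (auto simp: G_def)
  qed
  ultimately show "negligible (?E \<inter> cbox a b)" by (rule negligible_subset)
qed

text \<open>The function \<open>- F (- t)\<close> of \<open>t\<close> is again monotone and
  continuous, and its right quotients are left quotients of \<open>F\<close>. The gap lemma applies
  to it, and reflection preserves null sets.\<close>

lemma negligible_Dini_gap_left:
  fixes F :: "real \<Rightarrow> real"
  assumes F: "mono F" "continuous_on UNIV F" and pq: "0 < p" "p < q"
  shows "negligible {x. (\<exists>\<^sub>F y in at_left x. q * (x - y) < F x - F y) \<and>
                        (\<exists>\<^sub>F y in at_right x. F y - F x < p * (y - x))}" (is "negligible ?E")
proof -
  let ?G = "\<lambda>t. - F (- t)"
  let ?E' = "{x. (\<exists>\<^sub>F y in at_right x. q * (y - x) < ?G y - ?G x) \<and>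
                 (\<exists>\<^sub>F y in at_left x. ?G x - ?G y < p * (x - y))}"
  have "negligible ?E'"
  proof (rule negligible_Dini_gap[OF _ _ pq])
    show "mono ?G" using F(1) by (simp add: mono_def)
    show "continuous_on UNIV ?G"
      by (intro continuous_on_minus continuous_on_compose2[OF F(2)] continuous_intros) auto
  qed
  then have "negligible (uminus ` ?E')"
    by (intro negligible_differentiable_image_negligible linear_imp_differentiable_on linear_uminus) auto
  moreover have "?E \<subseteq> uminus ` ?E'"
  proof
    fix x assume x: "x \<in> ?E"
    have eq: "q * (x - - y) < F x - F (- y) \<longleftrightarrow> q * (y - - x) < ?G y - ?G (- x)"
      "F (- y) - F x < p * (- y - x) \<longleftrightarrow> ?G (- x) - ?G y < p * (- x - y)" for y
      by (simp_all add: algebra_simps)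
    have "\<exists>\<^sub>F y in at_left x. q * (x - y) < F x - F y" using x by blast
    then have "\<exists>\<^sub>F y in at_right (- x). q * (y - - x) < ?G y - ?G (- x)"
      by (subst (asm) at_left_minus) (simp only: frequently_filtermap eq)
    moreover have "\<exists>\<^sub>F y in at_right x. F y - F x < p * (y - x)" using x by blast
    then have "\<exists>\<^sub>F y in at_left (- x). ?G (- x) - ?G y < p * (- x - y)"
      by (subst (asm) at_right_minus) (simp only: frequently_filtermap eq)
    ultimately have "- x \<in> ?E'" by (intro CollectI conjI)
    then show "x \<in> uminus ` ?E'" by (rule image_eqI[rotated]) simp
  qed
  ultimately show ?thesis by (rule negligible_subset)
qed

text \<open>Off \<open>N\<close> no rational pair separates a Dini derivative from the opposite one,
  so all four agree; excluding \<open>E3\<close> makes the common value finite. Rational pairs keep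
  the union of exceptional sets countable.\<close>

theorem mono_continuous_differentiable_ae:
  fixes F :: "real \<Rightarrow> real"
  assumes F: "mono F" "continuous_on UNIV F"
  shows "negligible {x. \<not> F differentiable (at x)}"
proof -
  define E1 where "E1 = (\<lambda>p q. {x. (\<exists>\<^sub>F y in at_right x. q * (y - x) < F y - F x) \<and>
                                      (\<exists>\<^sub>F y in at_left x. F x - F y < p * (x - y))})"
  define E2 where "E2 = (\<lambda>p q. {x. (\<exists>\<^sub>F y in at_left x. q * (x - y) < F x - F y) \<and>
                                      (\<exists>\<^sub>F y in at_right x. F y - F x < p * (y - x))})"
  define E3 where "E3 = {x. \<forall>n. \<exists>\<^sub>F y in at_right x. real (Suc n) * (y - x) < F y - F x}"
  define I where "I = {(p, q). p \<in> \<rat> \<and> q \<in> \<rat> \<and> 0 < p \<and> p < (q::real)}"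
  define N where "N = (\<Union>(p, q)\<in>I. E1 p q \<union> E2 p q) \<union> E3"
  have "I \<subseteq> \<rat> \<times> \<rat>" by (auto simp: I_def)
  then have "countable I"
    by (rule countable_subset) (auto intro: countable_rat)
  moreover have "negligible (E1 (fst i) (snd i) \<union> E2 (fst i) (snd i))" if "i \<in> I" for i
    unfolding E1_def E2_def using that
    by (intro negligible_Un negligible_Dini_gap[OF F] negligible_Dini_gap_left[OF F])
      (simp_all add: I_def case_prod_beta)
  ultimately have "negligible (\<Union>((\<lambda>i. E1 (fst i) (snd i) \<union> E2 (fst i) (snd i)) ` I))"
    by (intro negligible_countable_Union) auto
  moreover have "negligible E3"
    unfolding E3_def by (rule negligible_Dini_infinite[OF F])
  ultimately have "negligible N"
    unfolding N_def case_prod_beta by (rule negligible_Un)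
  moreover have "{x. \<not> F differentiable (at x)} \<subseteq> N"
  proof
    fix x assume x: "x \<in> {x. \<not> F differentiable (at x)}"
    show "x \<in> N"
    proof (rule ccontr)
      assume nN: "x \<notin> N"
      define s where "s = (\<lambda>y. (F y - F x) / (y - x))"
      define sl where "sl = (\<lambda>y. ereal (s y))"
      have pos: "s y \<ge> 0" for y
        using F(1) by (cases y x rule: linorder_cases)
          (auto simp: s_def mono_def divide_nonpos_nonpos)
      have n1: False if "p \<in> \<rat>" "q \<in> \<rat>" "0 < p" "p < q" "x \<in> E1 p q \<union> E2 p q" for p q
        using nN that by (auto simp: N_def I_def)
      \<comment> \<open>Stated for two filters so that it serves both sides of \<open>x\<close>. If
        the inequality failed, rationals \<open>p < q\<close> would fit strictly in between;
        \<open>p\<close> is positive because some slope lies below it and slopes of a monotone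
        function are nonnegative.\<close>
      have gap: "Limsup A sl \<le> Liminf B sl"
        if AB: "\<And>p q. 0 < p \<Longrightarrow> p < q \<Longrightarrow> p \<in> \<rat> \<Longrightarrow> q \<in> \<rat> \<Longrightarrow>
             \<exists>\<^sub>F y in A. q < s y \<Longrightarrow> \<exists>\<^sub>F y in B. s y < p \<Longrightarrow> False" for A B
      proof (rule ccontr)
        assume "\<not> Limsup A sl \<le> Liminf B sl"
        then have less: "Liminf B sl < Limsup A sl" by simp
        obtain p where p: "Liminf B sl < ereal (real_of_rat p)" "ereal (real_of_rat p) < Limsup A sl"
          using ereal_dense3[OF less] by blast
        obtain q where q: "ereal (real_of_rat p) < ereal (real_of_rat q)" "ereal (real_of_rat q) < Limsup A sl"
          using ereal_dense3[OF p(2)] by blast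
        have "\<exists>\<^sub>F y in A. real_of_rat q < s y"
        proof (rule ccontr)
          assume "\<not> ?thesis"
          then have "\<forall>\<^sub>F y in A. sl y \<le> ereal (real_of_rat q)"
            by (simp add: not_frequently not_less sl_def)
          then show False using Limsup_bounded q(2) by (metis not_le)
        qed
        moreover have fr: "\<exists>\<^sub>F y in B. s y < real_of_rat p"
        proof (rule ccontr)
          assume "\<not> ?thesis"
          then have "\<forall>\<^sub>F y in B. ereal (real_of_rat p) \<le> sl y"
            by (simp add: not_frequently not_less sl_def)
          then show False using Liminf_bounded p(1) by (metis not_le)
        qed
        moreover have "0 < real_of_rat p"
          using frequently_ex[OF fr] pos by (meson le_less_trans)
        ultimately show False using AB[of "real_of_rat p" "real_of_rat q"] q(1) by simp
      qed
      have r: "\<forall>\<^sub>F y in at_right x. x < y" and l: "\<forall>\<^sub>F y in at_left x. y < x"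
        by (auto simp: eventually_at_filter)
      have sr: "q < s y \<longleftrightarrow> q * (y - x) < F y - F x" "s y < q \<longleftrightarrow> F y - F x < q * (y - x)" if "x < y" for y q
        using that by (simp_all add: s_def field_simps)
      have sl': "q < s y \<longleftrightarrow> q * (x - y) < F x - F y" "s y < q \<longleftrightarrow> F x - F y < q * (x - y)" if "y < x" for y q
        using that by (simp_all add: s_def field_simps)
      have frr: "(\<exists>\<^sub>F y in at_right x. q < s y) \<longleftrightarrow> (\<exists>\<^sub>F y in at_right x. q * (y - x) < F y - F x)"
        "(\<exists>\<^sub>F y in at_right x. s y < q) \<longleftrightarrow> (\<exists>\<^sub>F y in at_right x. F y - F x < q * (y - x))" for q
        by (rule frequently_cong[OF r]; simp add: sr)+
      have frl: "(\<exists>\<^sub>F y in at_left x. q < s y) \<longleftrightarrow> (\<exists>\<^sub>F y in at_left x. q * (x - y) < F x - F y)"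
        "(\<exists>\<^sub>F y in at_left x. s y < q) \<longleftrightarrow> (\<exists>\<^sub>F y in at_left x. F x - F y < q * (x - y))" for q
        by (rule frequently_cong[OF l]; simp add: sl')+
      have "Limsup (at_right x) sl \<le> Liminf (at_left x) sl"
      proof (rule gap)
        fix p q assume "0 < p" "p < q" "p \<in> \<rat>" "q \<in> \<rat>"
          "\<exists>\<^sub>F y in at_right x. q < s y" "\<exists>\<^sub>F y in at_left x. s y < p"
        then show False by (intro n1[of p q]) (auto simp: E1_def frr frl)
      qed
      moreover have "Limsup (at_left x) sl \<le> Liminf (at_right x) sl"
      proof (rule gap)
        fix p q assume "0 < p" "p < q" "p \<in> \<rat>" "q \<in> \<rat>"
          "\<exists>\<^sub>F y in at_left x. q < s y" "\<exists>\<^sub>F y in at_right x. s y < p"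
        then show False by (intro n1[of p q]) (auto simp: E2_def frr frl)
      qed
      moreover have "Liminf (at_left x) sl \<le> Limsup (at_left x) sl"
        "Liminf (at_right x) sl \<le> Limsup (at_right x) sl"
        by (auto intro!: Liminf_le_Limsup)
      moreover define D where "D = Limsup (at_right x) sl"
      \<comment> \<open>The inequalities form a cycle: upper right, lower left, upper left, lower
        right, and back to upper right.\<close>
      ultimately have D: "Limsup (at_right x) sl = D" "Liminf (at_right x) sl = D"
        "Limsup (at_left x) sl = D" "Liminf (at_left x) sl = D"
        by (auto intro: antisym order_trans)
      \<comment> \<open>Right slopes alone decide finiteness, since all four limits already equal
        \<open>D\<close>.\<close>
      obtain n where "\<not> (\<exists>\<^sub>F y in at_right x. real (Suc n) * (y - x) < F y - F x)"
        using nN by (auto simp: N_def E3_def)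
      then have "\<forall>\<^sub>F y in at_right x. sl y \<le> ereal (real (Suc n))"
        unfolding frr(1)[symmetric] by (simp add: not_frequently not_less sl_def)
      then have "D \<le> ereal (real (Suc n))" unfolding D(1)[symmetric] by (rule Limsup_bounded)
      moreover have "0 \<le> D"
        unfolding D(2)[symmetric] by (rule Liminf_bounded) (auto simp: sl_def pos)
      ultimately obtain d where d: "D = ereal d" by (cases D) auto
      have "(sl \<longlongrightarrow> D) (at_right x)" "(sl \<longlongrightarrow> D) (at_left x)"
        using D by (auto intro!: Liminf_eq_Limsup)
      then have "(s \<longlongrightarrow> d) (at x)"
        by (simp add: sl_def d filterlim_at_split)
      then have "(F has_field_derivative d) (at x)"
        by (simp add: has_field_derivative_iff s_def[abs_def])
      then show False
        using x field_differentiable_def field_differentiable_imp_differentiable by blast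
    qed
  qed
  ultimately show ?thesis by (rule negligible_subset)
qed

section \<open>Absolutely continuous functions\<close>

text \<open>One admissible answer \<open>\<delta>\<close> to a given \<open>\<epsilon>\<close>,
  named so that a chosen \<open>\<delta>\<close> can be handed from lemma to lemma.\<close>

definition abs_cont_modulus :: "real \<Rightarrow> real \<Rightarrow> (real \<Rightarrow> real) \<Rightarrow> real \<Rightarrow> real \<Rightarrow> bool" where
  "abs_cont_modulus a b f \<epsilon> \<delta> \<longleftrightarrow>
     0 < \<delta> \<and>
     (\<forall>(n::nat) (u::nat \<Rightarrow> real) (v::nat \<Rightarrow> real).
        (\<forall>k<n. a \<le> u k \<and> u k \<le> v k \<and> v k \<le> b) \<and>
        (\<forall>i j. i < j \<and> j < n \<longrightarrow> v i \<le> u j) \<and>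
        (\<Sum>k<n. v k - u k) < \<delta>
        \<longrightarrow> (\<Sum>k<n. \<bar>f (v k) - f (u k)\<bar>) < \<epsilon>)"

lemma abs_cont_onE:
  assumes "abs_cont_on a b f" "0 < \<epsilon>"
  obtains \<delta> where "abs_cont_modulus a b f \<epsilon> \<delta>"
proof -
  have "\<exists>\<delta>. abs_cont_modulus a b f \<epsilon> \<delta>"
    using assms(1)[unfolded abs_cont_on_def, rule_format, OF assms(2)]
    unfolding abs_cont_modulus_def .
  then show thesis using that by (elim exE)
qed

lemma abs_cont_modulusD:
  fixes n :: nat
  assumes "abs_cont_modulus a b f \<epsilon> \<delta>"
    and "\<And>k. k < n \<Longrightarrow> a \<le> u k \<and> u k \<le> v k \<and> v k \<le> b"
    and "\<And>i j. \<lbrakk>i < j; j < n\<rbrakk> \<Longrightarrow> v i \<le> u j"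
    and "(\<Sum>k<n. v k - u k) < \<delta>"
  shows "(\<Sum>k<n. \<bar>f (v k) - f (u k)\<bar>) < \<epsilon>"
proof -
  have "(\<forall>k<n. a \<le> u k \<and> u k \<le> v k \<and> v k \<le> b) \<and>
        (\<forall>i j. i < j \<and> j < n \<longrightarrow> v i \<le> u j) \<and> (\<Sum>k<n. v k - u k) < \<delta>"
    using assms(2-) by simp
  then show ?thesis
    using assms(1)[unfolded abs_cont_modulus_def, THEN conjunct2, THEN spec, THEN spec, THEN spec, of n u v]
    by (elim mp)
qed

lemma abs_cont_on_imp_continuous_on:
  assumes "abs_cont_on a b f"
  shows "continuous_on {a..b} f"
  unfolding continuous_on_iff
proof (intro ballI allI impI)
  fix x \<epsilon> :: real assume x: "x \<in> {a..b}" and "0 < \<epsilon>"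
  obtain \<delta> where \<delta>: "abs_cont_modulus a b f \<epsilon> \<delta>"
    using abs_cont_onE[OF assms \<open>0 < \<epsilon>\<close>] .
  then have "0 < \<delta>" by (simp add: abs_cont_modulus_def)
  have "dist (f y) (f x) < \<epsilon>" if y: "y \<in> {a..b}" "dist y x < \<delta>" for y
    using abs_cont_modulusD[OF \<delta>, of 1 "\<lambda>_. min x y" "\<lambda>_. max x y"] x y
    by (cases "x \<le> y") (auto simp: dist_real_def min_def max_def)
  then show "\<exists>d>0. \<forall>y\<in>{a..b}. dist y x < d \<longrightarrow> dist (f y) (f x) < \<epsilon>"
    using \<open>0 < \<delta>\<close> by blast
qed

text \<open>Partitions are infinite monotone sequences of which only \<open>p 0\<close> to
  \<open>p n\<close> are read; nodes may repeat and need not reach \<open>a\<close> or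
  \<open>t\<close>. This makes appending and clipping easy, and for \<open>a \<le> t\<close> the
  supremum is still the total variation of \<open>f\<close> between \<open>a\<close> and
  \<open>t\<close>.\<close>

definition variation_sums :: "(real \<Rightarrow> real) \<Rightarrow> real \<Rightarrow> real \<Rightarrow> real set" where
  "variation_sums f a t =
     {v. \<exists>n p. mono p \<and> range p \<subseteq> {a..t} \<and> v = (\<Sum>k<(n::nat). \<bar>f (p (Suc k)) - f (p k)\<bar>)}"

lemma zero_in_variation_sums: "a \<le> t \<Longrightarrow> 0 \<in> variation_sums f a t"
  unfolding variation_sums_def by (auto simp: mono_def intro!: exI[of _ 0] exI[of _ "\<lambda>_. a"])

lemma variation_sums_extend:
  assumes v: "v \<in> variation_sums f a s" and "s \<le> t"
  shows "\<exists>v'\<in>variation_sums f a t. v + \<bar>f t - f s\<bar> \<le> v'"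
proof -
  obtain n p where p: "mono p" "range p \<subseteq> {a..s}" and v: "v = (\<Sum>k<n. \<bar>f (p (Suc k)) - f (p k)\<bar>)"
    using v unfolding variation_sums_def by blast
  have ps: "a \<le> p k" "p k \<le> s" for k using p(2) rangeI[of p k] by (simp_all add: subset_iff)
  \<comment> \<open>Two nodes are appended: \<open>s\<close> at index \<open>n + 1\<close> and
    \<open>t\<close> from \<open>n + 2\<close> on. The step from \<open>p n\<close> to
    \<open>s\<close> adds a nonnegative amount, the next one adds the required increment.\<close>
  define p' where "p' = (\<lambda>k. if k \<le> n then p k else if k = Suc n then s else t)"
  have pt: "p k \<le> t" "a \<le> t" for k using ps[of k] assms(2) by auto
  have "mono p'"
    using ps pt assms(2) monoD[OF p(1)] unfolding mono_def p'_def by simp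
  moreover have "range p' \<subseteq> {a..t}"
    using ps pt assms(2) order_trans[OF ps(1)[of 0] ps(2)[of 0]] by (simp add: p'_def image_subset_iff)
  ultimately have "(\<Sum>k<n + 2. \<bar>f (p' (Suc k)) - f (p' k)\<bar>) \<in> variation_sums f a t"
    unfolding variation_sums_def by blast
  moreover have "(\<Sum>k<n + 2. \<bar>f (p' (Suc k)) - f (p' k)\<bar>) = v + \<bar>f s - f (p n)\<bar> + \<bar>f t - f s\<bar>"
    by (simp add: v p'_def)
  ultimately show ?thesis by (intro bexI) auto
qed

text \<open>Clipping a partition at \<open>s\<close> splits its sum into one part before and one
  part after \<open>s\<close>. The latter covers a length below \<open>\<delta>\<close>, so absolute
  continuity makes it less than \<open>\<epsilon>\<close>. This one estimate yields both finiteness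
  and continuity of the total variation.\<close>

lemma abs_cont_on_variation_sums:
  assumes "abs_cont_on a b f" "0 < \<epsilon>"
  obtains \<delta> where "0 < \<delta>"
    "\<And>s t v. \<lbrakk>a \<le> s; s \<le> t; t \<le> b; t - s < \<delta>; v \<in> variation_sums f a t\<rbrakk>
       \<Longrightarrow> \<exists>v'\<in>variation_sums f a s. v \<le> v' + \<epsilon>"
proof -
  obtain \<delta> where \<delta>: "abs_cont_modulus a b f \<epsilon> \<delta>"
    using abs_cont_onE[OF assms] .
  then have "0 < \<delta>" by (simp add: abs_cont_modulus_def)
  show thesis
  proof (rule that[OF \<open>0 < \<delta>\<close>])
    fix s t v assume st: "a \<le> s" "s \<le> t" "t \<le> b" "t - s < \<delta>" and "v \<in> variation_sums f a t"
    then obtain n p where p: "mono p" "range p \<subseteq> {a..t}" and v: "v = (\<Sum>k<n. \<bar>f (p (Suc k)) - f (p k)\<bar>)"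
      unfolding variation_sums_def by blast
    have pt: "a \<le> p k" "p k \<le> t" for k using p(2) rangeI[of p k] by (simp_all add: subset_iff)
    have pS: "p k \<le> p (Suc k)" for k using monoD[OF p(1), of k "Suc k"] by simp
    define q where "q = (\<lambda>k. min s (p k))"
    define r where "r = (\<lambda>k. max s (p k))"
    \<comment> \<open>One of \<open>q k\<close> and \<open>r k\<close> is \<open>s\<close>, the
      other is \<open>p k\<close>.\<close>
    have qr: "f (p k) = f (q k) + f (r k) - f s" for k
      by (auto simp: q_def r_def min_def max_def)
    have "v \<le> (\<Sum>k<n. \<bar>f (q (Suc k)) - f (q k)\<bar> + \<bar>f (r (Suc k)) - f (r k)\<bar>)"
      unfolding v by (rule sum_mono) (simp add: qr)
    also have "\<dots> = (\<Sum>k<n. \<bar>f (q (Suc k)) - f (q k)\<bar>) + (\<Sum>k<n. \<bar>f (r (Suc k)) - f (r k)\<bar>)"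
      by (rule sum.distrib)
    finally have 1: "v \<le> \<dots>" .
    have "(\<Sum>k<n. r (Suc k) - r k) = r n - r 0" by (rule sum_lessThan_telescope)
    also have "\<dots> < \<delta>" using pt[of n] st by (auto simp: r_def max_def)
    finally have sum: "(\<Sum>k<n. r (Suc k) - r k) < \<delta>" .
    have bounds: "a \<le> r k \<and> r k \<le> r (Suc k) \<and> r (Suc k) \<le> b" for k
      using pt[of k] pt[of "Suc k"] pS[of k] st by (auto simp: r_def)
    have disj: "r (Suc i) \<le> r j" if "i < j" for i j
      using monoD[OF p(1), of "Suc i" j] that by (auto simp: r_def)
    have "(\<Sum>k<n. \<bar>f (r (Suc k)) - f (r k)\<bar>) < \<epsilon>"
      by (rule abs_cont_modulusD[OF \<delta> bounds disj sum])
    moreover have "(\<Sum>k<n. \<bar>f (q (Suc k)) - f (q k)\<bar>) \<in> variation_sums f a s"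
      unfolding variation_sums_def mem_Collect_eq
    proof (intro exI[of _ n] exI[of _ q] conjI)
      show "mono q" using p(1) by (auto simp: q_def mono_def intro: min.coboundedI2)
      show "range q \<subseteq> {a..s}" using pt st by (auto simp: q_def)
    qed simp
    ultimately show "\<exists>v'\<in>variation_sums f a s. v \<le> v' + \<epsilon>" using 1 by force
  qed
qed

lemma variation_sums_bdd_above:
  assumes ac: "abs_cont_on a b f" and t: "t \<in> {a..b}"
  shows "bdd_above (variation_sums f a t)"
proof -
  obtain \<delta> where \<delta>: "0 < \<delta>" and *:
    "\<And>s t v. \<lbrakk>a \<le> s; s \<le> t; t \<le> b; t - s < \<delta>; v \<in> variation_sums f a t\<rbrakk>
       \<Longrightarrow> \<exists>v'\<in>variation_sums f a s. v \<le> v' + 1"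
    using abs_cont_on_variation_sums[OF ac zero_less_one] by metis
  \<comment> \<open>Advancing by half of \<open>\<delta>\<close> keeps the strict bound
    \<open>t - s < \<delta>\<close>; each advance raises the upper bound by 1.\<close>
  have "\<forall>t\<in>{a..b}. t \<le> a + real n * (\<delta> / 2) \<longrightarrow> bdd_above (variation_sums f a t)" for n
  proof (induction n)
    case 0
    have "v \<le> 0" if v: "v \<in> variation_sums f a a" for v
    proof -
      obtain n p where p: "range p \<subseteq> {a..a}" and v: "v = (\<Sum>k<n. \<bar>f (p (Suc k)) - f (p k)\<bar>)"
        using v unfolding variation_sums_def by blast
      have "p k = a" for k using p by (metis atLeastAtMost_singleton rangeI singletonD subsetD)
      then show ?thesis using v by simp
    qed
    then have "bdd_above (variation_sums f a a)" by (rule bdd_aboveI)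
    then show ?case by (metis add.right_neutral atLeastAtMost_iff mult_zero_left of_nat_0 order_antisym)
  next
    case (Suc n)
    show ?case
    proof (intro ballI impI)
      fix t assume t: "t \<in> {a..b}" "t \<le> a + real (Suc n) * (\<delta> / 2)"
      define s where "s = max a (t - \<delta> / 2)"
      have s: "a \<le> s" "s \<le> t" "t - s < \<delta>"
        using t \<delta> by (auto simp: s_def max_def)
      have s': "s \<le> a + real n * (\<delta> / 2)"
        using t \<delta> by (simp add: s_def distrib_right add_divide_distrib)
      have "bdd_above (variation_sums f a s)" using Suc s s' t(1) by simp
      then obtain B where B: "\<And>v. v \<in> variation_sums f a s \<Longrightarrow> v \<le> B"
        unfolding bdd_above_def by blast
      show "bdd_above (variation_sums f a t)"
      proof (rule bdd_aboveI)
        fix v assume "v \<in> variation_sums f a t"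
        then show "v \<le> B + 1" using *[OF s(1,2) _ s(3)] t B by fastforce
      qed
    qed
  qed
  moreover obtain n where "t - a < real n * (\<delta> / 2)"
    using reals_Archimedean3[OF half_gt_zero[OF \<delta>]] by blast
  then have "t \<le> a + real n * (\<delta> / 2)" by simp
  ultimately show ?thesis using t by meson
qed

text \<open>The witness is the total variation. Appending a step to a partition gives the increment
  bound, and with it monotonicity; the clipping estimate gives continuity.\<close>

lemma abs_cont_on_variation:
  assumes ac: "abs_cont_on a b f"
  obtains g where "mono_on {a..b} g" "continuous_on {a..b} g"
    "\<And>s t. \<lbrakk>a \<le> s; s \<le> t; t \<le> b\<rbrakk> \<Longrightarrow> \<bar>f t - f s\<bar> \<le> g t - g s"
proof
  define V where "V = (\<lambda>t. Sup (variation_sums f a t))"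
  have bdd: "bdd_above (variation_sums f a t)" if "t \<in> {a..b}" for t
    using variation_sums_bdd_above[OF ac that] .
  have ne: "variation_sums f a t \<noteq> {}" if "a \<le> t" for t
    using zero_in_variation_sums[OF that] by blast
  show V: "\<bar>f t - f s\<bar> \<le> V t - V s" if st: "a \<le> s" "s \<le> t" "t \<le> b" for s t
  proof -
    have "V s \<le> V t - \<bar>f t - f s\<bar>"
      unfolding V_def
    proof (rule cSup_least[OF ne[OF st(1)]])
      fix v assume "v \<in> variation_sums f a s"
      then obtain v' where "v' \<in> variation_sums f a t" "v + \<bar>f t - f s\<bar> \<le> v'"
        using variation_sums_extend st by blast
      then show "v \<le> Sup (variation_sums f a t) - \<bar>f t - f s\<bar>"
        using cSup_upper[OF _ bdd, of v' t] st by auto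
    qed
    then show ?thesis by simp
  qed
  show "mono_on {a..b} V"
    by (rule mono_onI) (use V in fastforce)
  show "continuous_on {a..b} V"
    unfolding continuous_on_iff
  proof (intro ballI allI impI)
    fix x \<epsilon> :: real assume x: "x \<in> {a..b}" and "0 < \<epsilon>"
    obtain \<delta> where \<delta>: "0 < \<delta>" and *:
      "\<And>s t v. \<lbrakk>a \<le> s; s \<le> t; t \<le> b; t - s < \<delta>; v \<in> variation_sums f a t\<rbrakk>
         \<Longrightarrow> \<exists>v'\<in>variation_sums f a s. v \<le> v' + \<epsilon> / 2"
      using abs_cont_on_variation_sums[OF ac half_gt_zero[OF \<open>0 < \<epsilon>\<close>]] by metis
    have le: "V t \<le> V s + \<epsilon> / 2" if st: "a \<le> s" "s \<le> t" "t \<le> b" "t - s < \<delta>" for s t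
      unfolding V_def
    proof (rule cSup_least)
      show "variation_sums f a t \<noteq> {}" using ne st by simp
      fix v assume "v \<in> variation_sums f a t"
      then obtain v' where "v' \<in> variation_sums f a s" "v \<le> v' + \<epsilon> / 2"
        using * st by blast
      then show "v \<le> Sup (variation_sums f a s) + \<epsilon> / 2"
        using cSup_upper[OF _ bdd, of v' s] st by auto
    qed
    have "dist (V y) (V x) < \<epsilon>" if y: "y \<in> {a..b}" "dist y x < \<delta>" for y
      using le[of x y] le[of y x] V[of x y] V[of y x] x y \<open>0 < \<epsilon>\<close>
      by (cases "x \<le> y") (auto simp: dist_real_def abs_if split: if_splits)
    then show "\<exists>d>0. \<forall>y\<in>{a..b}. dist y x < d \<longrightarrow> dist (V y) (V x) < \<epsilon>" using \<delta> by blast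
  qed
qed

section \<open>Differentiability almost everywhere\<close>

lemma mono_on_continuous_differentiable_ae:
  fixes g :: "real \<Rightarrow> real"
  assumes g: "mono_on {a..b} g" "continuous_on {a..b} g" and "a \<le> b"
  shows "negligible {t \<in> {a<..<b}. \<not> g differentiable (at t)}"
proof -
  \<comment> \<open>Clamping the argument extends \<open>g\<close> to a monotone continuous function
    on the whole line that agrees with \<open>g\<close> near every point of the open
    interval.\<close>
  define F where "F = (\<lambda>t. g (max a (min b t)))"
  have "mono F" unfolding F_def mono_def
    using \<open>a \<le> b\<close> by (auto intro!: mono_onD[OF g(1)])
  moreover have "continuous_on UNIV F"
    unfolding F_def using \<open>a \<le> b\<close>
    by (intro continuous_on_compose2[OF g(2)] continuous_intros) auto
  ultimately have "negligible {t. \<not> F differentiable (at t)}"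
    by (rule mono_continuous_differentiable_ae)
  moreover have "g differentiable (at t)" if t: "t \<in> {a<..<b}" "F differentiable (at t)" for t
  proof -
    obtain D where "(F has_derivative D) (at t)" using t(2) by (auto simp: differentiable_def)
    then have "(g has_derivative D) (at t)"
      by (rule has_derivative_transform_within_open[OF _ open_greaterThanLessThan t(1)]) (simp add: F_def)
    then show ?thesis by (auto simp: differentiable_def)
  qed
  ultimately show ?thesis by (elim negligible_subset) auto
qed

text \<open>Jordan decomposition: \<open>f\<close> is the difference of \<open>g + f\<close> and
  \<open>g\<close>, both monotone because \<open>g\<close> dominates the increments of
  \<open>f\<close>.\<close>

theorem abs_cont_on_differentiable_ae:
  assumes ac: "abs_cont_on a b f" and "a \<le> b"
  shows "negligible {t \<in> {a<..<b}. \<not> f differentiable (at t)}"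
proof -
  obtain g where g: "mono_on {a..b} g" "continuous_on {a..b} g"
    and fg: "\<And>s t. \<lbrakk>a \<le> s; s \<le> t; t \<le> b\<rbrakk> \<Longrightarrow> \<bar>f t - f s\<bar> \<le> g t - g s"
    using abs_cont_on_variation[OF ac] by metis
  have "mono_on {a..b} (\<lambda>t. g t + f t)"
  proof (rule mono_onI)
    fix s t assume "s \<in> {a..b}" "t \<in> {a..b}" "s \<le> t"
    then show "g s + f s \<le> g t + f t" using fg[of s t] by auto
  qed
  then have "negligible {t \<in> {a<..<b}. \<not> (\<lambda>t. g t + f t) differentiable (at t)}"
    using \<open>a \<le> b\<close>
    by (intro mono_on_continuous_differentiable_ae continuous_on_add g abs_cont_on_imp_continuous_on[OF ac])
  moreover have "negligible {t \<in> {a<..<b}. \<not> g differentiable (at t)}"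
    using g \<open>a \<le> b\<close> by (rule mono_on_continuous_differentiable_ae)
  ultimately have "negligible ({t \<in> {a<..<b}. \<not> g differentiable (at t)} \<union>
      {t \<in> {a<..<b}. \<not> (\<lambda>t. g t + f t) differentiable (at t)})"
    by (simp add: negligible_Un)
  moreover have "f differentiable (at t)"
    if "g differentiable (at t)" "(\<lambda>t. g t + f t) differentiable (at t)" for t
    using differentiable_diff[OF that(2,1)] by simp
  ultimately show ?thesis by (elim negligible_subset) auto
qed

section \<open>The fundamental theorem for absolutely continuous functions\<close>

lemma abs_cont_modulus_tagged:
  assumes mod: "abs_cont_modulus a b f \<epsilon> \<delta>"
    and p: "p tagged_partial_division_of {a..b}"
    and small: "(\<Sum>(x,K)\<in>p. measure lborel K) < \<delta>"
  shows "(\<Sum>(x,K)\<in>p. \<bar>f (Sup K) - f (Inf K)\<bar>) < \<epsilon>"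
proof -
  have fin: "finite p" using p by (simp add: tagged_partial_division_of_def)
  have K: "K = {Inf K..Sup K} \<and> Inf K \<le> Sup K \<and> a \<le> Inf K \<and> Sup K \<le> b" if "(x, K) \<in> p" for x K
  proof -
    have xK: "x \<in> K" "K \<subseteq> {a..b}"
      using tagged_partial_division_ofD(2,3)[OF p that] .
    obtain u v where "K = cbox u v"
      using tagged_partial_division_ofD(4)[OF p \<open>(x, K) \<in> p\<close>] by auto
    note uv = this xK
    from uv have "u \<le> v" by auto
    then show ?thesis using uv by auto
  qed
  define \<kappa> :: "real \<times> real set \<Rightarrow> real" where "\<kappa> = (\<lambda>q. Inf (snd q))"
  define \<mu> :: "real \<times> real set \<Rightarrow> real" where "\<mu> = (\<lambda>q. Sup (snd q))"
  \<comment> \<open>Degenerate cells are discarded: one could sit in the interior of another cell,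
    and then no ordering would separate the two. They add zero to both sums.\<close>
  define p' where "p' = {q \<in> p. \<kappa> q < \<mu> q}"
  have "finite p'" using fin by (simp add: p'_def)
  then obtain xs where xs: "set xs = p'" "distinct xs" using finite_distinct_list by blast
  \<comment> \<open>Sorting by left endpoint turns the set of cells into the ordered family that
    \<open>abs_cont_modulus\<close> speaks about.\<close>
  define ys where "ys = sort_key \<kappa> xs"
  define n where "n = length ys"
  have ys: "set ys = p'" "distinct ys" "sorted (map \<kappa> ys)"
    using xs by (simp_all add: ys_def)
  have bij: "bij_betw (\<lambda>k. ys ! k) {..<n} p'"
    using bij_betw_nth[OF ys(2)] ys(1) by (simp add: n_def)
  have in_p': "ys ! k \<in> p'" if "k < n" for k
    using that ys(1) by (metis n_def nth_mem)
  have K': "snd q = {\<kappa> q..\<mu> q} \<and> \<kappa> q < \<mu> q \<and> a \<le> \<kappa> q \<and> \<mu> q \<le> b" if "q \<in> p'" for q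
    using K[of "fst q" "snd q"] that by (simp add: p'_def \<kappa>_def \<mu>_def)
  have content: "measure lborel (snd q) = \<mu> q - \<kappa> q" if "q \<in> p" for q
    using K[of "fst q" "snd q"] that by (metis \<kappa>_def \<mu>_def content_real prod.collapse)
  have zero: "\<mu> q = \<kappa> q" if "q \<in> p - p'" for q
    using K[of "fst q" "snd q"] that by (auto simp: p'_def \<kappa>_def \<mu>_def)
  have sub: "p' \<subseteq> p" by (auto simp: p'_def)
  have "(\<Sum>k<n. \<bar>f (\<mu> (ys ! k)) - f (\<kappa> (ys ! k))\<bar>) < \<epsilon>"
  proof (rule abs_cont_modulusD[OF mod])
    fix k assume "k < n"
    then show "a \<le> \<kappa> (ys ! k) \<and> \<kappa> (ys ! k) \<le> \<mu> (ys ! k) \<and> \<mu> (ys ! k) \<le> b"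
      using K'[OF in_p'] by (simp add: less_imp_le)
  next
    fix i j assume ij: "i < j" "j < n"
    then have i: "i < n" by simp
    show "\<mu> (ys ! i) \<le> \<kappa> (ys ! j)"
    proof (rule ccontr)
      assume less: "\<not> \<mu> (ys ! i) \<le> \<kappa> (ys ! j)"
      have le: "\<kappa> (ys ! i) \<le> \<kappa> (ys ! j)"
        using sorted_nth_mono[OF ys(3), of i j] ij i by (simp add: n_def)
      have ne: "ys ! i \<noteq> ys ! j"
        using ij i ys(2) by (simp add: n_def nth_eq_iff_index_eq)
      have "interior (snd (ys ! i)) \<inter> interior (snd (ys ! j)) = {}"
        using tagged_partial_division_ofD(5)[OF p, of "fst (ys ! i)" "snd (ys ! i)" "fst (ys ! j)" "snd (ys ! j)"]
          subsetD[OF sub in_p'[OF i]] subsetD[OF sub in_p'[OF ij(2)]] ne by simp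
      then have "{\<kappa> (ys ! i)<..<\<mu> (ys ! i)} \<inter> {\<kappa> (ys ! j)<..<\<mu> (ys ! j)} = {}"
        using K'[OF in_p'[OF i]] K'[OF in_p'[OF ij(2)]] interior_atLeastAtMost_real by metis
      \<comment> \<open>If two sorted cells overlapped, a point just to the right of the later left
        endpoint would be interior to both.\<close>
      moreover obtain w where "\<kappa> (ys ! j) < w" "w < min (\<mu> (ys ! i)) (\<mu> (ys ! j))"
        using dense[of "\<kappa> (ys ! j)" "min (\<mu> (ys ! i)) (\<mu> (ys ! j))"] less K'[OF in_p'[OF ij(2)]] by auto
      then have "w \<in> {\<kappa> (ys ! i)<..<\<mu> (ys ! i)} \<inter> {\<kappa> (ys ! j)<..<\<mu> (ys ! j)}"
        using le by auto
      ultimately show False by blast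
    qed
  next
    have "(\<Sum>k<n. \<mu> (ys ! k) - \<kappa> (ys ! k)) = (\<Sum>q\<in>p'. \<mu> q - \<kappa> q)"
      using sum.reindex_bij_betw[OF bij, of "\<lambda>q. \<mu> q - \<kappa> q"] .
    also have "\<dots> = (\<Sum>q\<in>p. \<mu> q - \<kappa> q)"
      using zero by (intro sum.mono_neutral_left fin sub) auto
    also have "\<dots> = (\<Sum>(x,K)\<in>p. measure lborel K)"
      using content by (intro sum.cong) (auto simp: case_prod_beta)
    finally show "(\<Sum>k<n. \<mu> (ys ! k) - \<kappa> (ys ! k)) < \<delta>" using small by simp
  qed
  also have "(\<Sum>k<n. \<bar>f (\<mu> (ys ! k)) - f (\<kappa> (ys ! k))\<bar>) = (\<Sum>q\<in>p'. \<bar>f (\<mu> q) - f (\<kappa> q)\<bar>)"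
    using sum.reindex_bij_betw[OF bij, of "\<lambda>q. \<bar>f (\<mu> q) - f (\<kappa> q)\<bar>"] .
  also have "\<dots> = (\<Sum>q\<in>p. \<bar>f (\<mu> q) - f (\<kappa> q)\<bar>)"
    using zero by (intro sum.mono_neutral_left fin sub) auto
  finally show ?thesis by (simp add: \<mu>_def \<kappa>_def case_prod_beta)
qed

text \<open>Two distinct cells meet in a convex set with empty interior, which is negligible, so the
  lengths add up to the measure of the union.\<close>

lemma tagged_partial_division_content_le:
  fixes p :: "(real \<times> real set) set"
  assumes p: "p tagged_partial_division_of S"
    and U: "U \<in> lmeasurable" "\<And>x K. (x, K) \<in> p \<Longrightarrow> K \<subseteq> U"
  shows "(\<Sum>(x,K)\<in>p. measure lborel K) \<le> measure lebesgue U"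
proof -
  have fin: "finite p" using p by (simp add: tagged_partial_division_of_def)
  have cb: "\<exists>u v. snd q = cbox u v" if "q \<in> p" for q
    using tagged_partial_division_ofD(4)[OF p, of "fst q" "snd q"] that by auto
  have "(\<Sum>q\<in>p. measure lebesgue (snd q)) = measure lebesgue (\<Union>(snd ` p))"
  proof (rule measure_negligible_finite_Union_image[OF fin, symmetric])
    show "snd q \<in> lmeasurable" if "q \<in> p" for q using cb[OF that] by auto
    show "pairwise (\<lambda>q r. negligible (snd q \<inter> snd r)) p"
    proof (rule pairwiseI)
      fix q r assume qr: "q \<in> p" "r \<in> p" "q \<noteq> r"
      then have "interior (snd q) \<inter> interior (snd r) = {}"
        using tagged_partial_division_ofD(5)[OF p, of "fst q" "snd q" "fst r" "snd r"] by simp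
      moreover have "convex (snd q \<inter> snd r)"
        using cb[OF qr(1)] cb[OF qr(2)] by (auto intro!: convex_Int)
      ultimately show "negligible (snd q \<inter> snd r)"
        by (simp add: negligible_convex_interior)
    qed
  qed
  also have "\<dots> \<le> measure lebesgue U"
  proof (rule measure_mono_fmeasurable)
    show "\<Union>(snd ` p) \<subseteq> U" using U(2) by fastforce
    have "snd q \<in> sets lebesgue" if "q \<in> p" for q
      using cb[OF that] by (metis lmeasurable_cbox fmeasurableD)
    then show "\<Union>(snd ` p) \<in> sets lebesgue" using fin by (intro sets.finite_UN) auto
  qed fact
  also have "(\<Sum>q\<in>p. measure lebesgue (snd q)) = (\<Sum>(x,K)\<in>p. measure lborel K)"
  proof (rule sum.cong)
    fix q assume "q \<in> p"
    then obtain u v where "snd q = cbox u v" using cb by blast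
    then show "measure lebesgue (snd q) = (case q of (x, K) \<Rightarrow> measure lborel K)"
      by (cases q) auto
  qed simp
  finally show ?thesis .
qed

text \<open>The straddle estimate handles tags at points of differentiability. The intervals with a tag in
  the exceptional null set lie in an open set of small measure, so absolute continuity bounds
  their contribution.\<close>

lemma abs_cont_on_has_integral:
  fixes f g :: "real \<Rightarrow> real"
  assumes ac: "abs_cont_on a b f" and cd: "c \<le> d" "{c..d} \<subseteq> {a..b}"
    and N: "negligible N"
    and der: "\<And>t. t \<in> {c..d} - N \<Longrightarrow> (f has_vector_derivative g t) (at t within {c..d})"
  shows "(g has_integral (f d - f c)) {c..d}"
proof -
  \<comment> \<open>With value zero on \<open>N\<close>, a cell tagged there contributes only the
    increment of \<open>f\<close>. The change on a null set is undone at the end.\<close>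
  define h where "h = (\<lambda>t. if t \<in> N then 0 else g t)"
  have "(h has_integral (f d - f c)) (cbox c d)"
    unfolding has_integral
  proof (intro allI impI)
    fix e :: real assume e: "e > 0"
    \<comment> \<open>The added 1 keeps the denominator positive when \<open>c = d\<close> and makes
      \<open>e1 * (d - c)\<close> strictly less than \<open>e / 2\<close>.\<close>
    define e1 where "e1 = e / (2 * (d - c + 1))"
    have e1: "e1 > 0" "e1 * (d - c) < e / 2"
      using e cd by (auto simp: e1_def field_simps)
    obtain \<delta> where mod: "abs_cont_modulus a b f (e / 2) \<delta>"
      using abs_cont_onE[OF ac half_gt_zero[OF e]] .
    then have "0 < \<delta>" by (simp add: abs_cont_modulus_def)
    obtain U where U: "open U" "N \<subseteq> U" "U - N \<in> lmeasurable" "emeasure lebesgue (U - N) < ennreal \<delta>"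
      using sets_lebesgue_outer_open[OF negligible_imp_sets[OF N] \<open>0 < \<delta>\<close>] .
    have UN: "U = (U - N) \<union> N" using U(2) by blast
    have Nm: "N \<in> lmeasurable" using N by (simp add: negligible_imp_measurable)
    have Um: "U \<in> lmeasurable"
      by (subst UN) (rule fmeasurable.Un[OF U(3) Nm])
    have "measure lebesgue (U - N) < \<delta>"
      using U(3,4) \<open>0 < \<delta>\<close> by (simp add: emeasure_eq_measure2 ennreal_less_iff)
    moreover have "measure lebesgue U \<le> measure lebesgue (U - N) + measure lebesgue N"
      by (subst UN) (rule measure_Un_le, use U(3) Nm in \<open>auto dest: fmeasurableD\<close>)
    ultimately have U\<delta>: "measure lebesgue U < \<delta>"
      using N by (simp add: negligible_imp_measure0)
    have "\<forall>x. \<exists>r>0. x \<in> {c..d} - N \<longrightarrow>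
        (\<forall>y\<in>{c..d}. norm (y - x) < r \<longrightarrow> norm (f y - f x - (y - x) *\<^sub>R g x) \<le> e1 * norm (y - x))"
      using der[unfolded has_vector_derivative_def has_derivative_within_alt] e1(1)
      by (metis zero_less_one)
    then obtain r where r: "\<And>x. r x > 0" "\<And>x y. \<lbrakk>x \<in> {c..d} - N; y \<in> {c..d}; norm (y - x) < r x\<rbrakk>
        \<Longrightarrow> norm (f y - f x - (y - x) *\<^sub>R g x) \<le> e1 * norm (y - x)"
      by metis
    define \<gamma> where "\<gamma> = (\<lambda>x. if x \<in> N then U else ball x (r x))"
    show "\<exists>\<gamma>. gauge \<gamma> \<and> (\<forall>p. p tagged_division_of cbox c d \<and> \<gamma> fine p \<longrightarrow>
           norm ((\<Sum>(x, K)\<in>p. measure lborel K *\<^sub>R h x) - (f d - f c)) < e)"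
    proof (intro exI[of _ \<gamma>] conjI allI impI)
      show "gauge \<gamma>"
        using U r(1) by (auto simp: \<gamma>_def gauge_def)
    next
      fix p assume "p tagged_division_of cbox c d \<and> \<gamma> fine p"
      then have p: "p tagged_division_of {c..d}" and fine: "\<gamma> fine p" by auto
      then have pp: "p tagged_partial_division_of {c..d}" by (simp add: tagged_division_of_def)
      have fin: "finite p" using p by (rule tagged_division_of_finite)
      define pN where "pN = {q \<in> p. fst q \<in> N}"
      define pG where "pG = {q \<in> p. fst q \<notin> N}"
      have split: "p = pG \<union> pN" "pG \<inter> pN = {}" by (auto simp: pG_def pN_def)
      define D where "D = (\<lambda>K. f (Sup K) - f (Inf K))"
      define T where "T = (\<lambda>q. measure lborel (snd q) *\<^sub>R h (fst q) - D (snd q))"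
      have len: "d - c = (\<Sum>(x,K)\<in>p. Sup K - Inf K)"
        using additive_tagged_division_1[OF cd(1) p, of "\<lambda>x. x"] by simp
      have fdc: "f d - f c = (\<Sum>q\<in>p. D (snd q))"
        using additive_tagged_division_1[OF cd(1) p, of f] by (simp add: D_def case_prod_beta)
      have "(\<Sum>(x, K)\<in>p. measure lborel K *\<^sub>R h x) - (f d - f c) = (\<Sum>q\<in>p. T q)"
        unfolding fdc T_def by (simp add: sum_subtractf case_prod_beta)
      also have "\<dots> = (\<Sum>q\<in>pG. T q) + (\<Sum>q\<in>pN. T q)"
        using fin split by (metis finite_Un sum.union_disjoint)
      finally have eq: "(\<Sum>(x, K)\<in>p. measure lborel K *\<^sub>R h x) - (f d - f c) =
        (\<Sum>q\<in>pG. T q) + (\<Sum>q\<in>pN. T q)" .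
      have K: "\<exists>u v. K = {u..v} \<and> u \<le> v \<and> c \<le> u \<and> v \<le> d \<and> x \<in> {u..v}" if "(x, K) \<in> p" for x K
      proof -
        have xK: "x \<in> K" "K \<subseteq> {c..d}"
          using tagged_partial_division_ofD(2,3)[OF pp that] .
        obtain u v where "K = cbox u v"
          using tagged_partial_division_ofD(4)[OF pp \<open>(x, K) \<in> p\<close>] by auto
        note uv = this xK
        from uv have "u \<le> v" by auto
        then show ?thesis using uv by (intro exI[of _ u] exI[of _ v]) auto
      qed
      have "norm (\<Sum>q\<in>pG. T q) \<le> (\<Sum>q\<in>pG. e1 * (Sup (snd q) - Inf (snd q)))"
      proof (rule sum_norm_le)
        fix q assume q: "q \<in> pG"
        obtain x K where xK: "q = (x, K)" by (cases q)
        have inp: "(x, K) \<in> p" "x \<notin> N" using q xK by (auto simp: pG_def)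
        obtain u v where uv: "K = {u..v}" "u \<le> v" "c \<le> u" "v \<le> d" "x \<in> {u..v}" using K[OF inp(1)] by blast
        have "K \<subseteq> \<gamma> x" using fine inp unfolding fine_def by blast
        then have "K \<subseteq> ball x (r x)" using inp(2) by (simp add: \<gamma>_def)
        moreover have "u \<in> K" "v \<in> K" using uv(1,2) by simp_all
        ultimately have "u \<in> ball x (r x)" "v \<in> ball x (r x)" by blast+
        then have "norm (u - x) < r x" "norm (v - x) < r x"
          by (simp_all add: dist_real_def abs_minus_commute)
        then have 1: "norm (f u - f x - (u - x) *\<^sub>R g x) \<le> e1 * norm (u - x)"
          "norm (f v - f x - (v - x) *\<^sub>R g x) \<le> e1 * norm (v - x)"
          using r(2)[of x u] r(2)[of x v] uv inp(2) by auto
        \<comment> \<open>The linearization errors at both ends of the cell refer to the same tag;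
          as \<open>u \<le> x \<le> v\<close>, their bounds add up to \<open>e1\<close> times the
          length of the cell.\<close>
        have "T q = (f u - f x - (u - x) *\<^sub>R g x) - (f v - f x - (v - x) *\<^sub>R g x)"
          using uv inp(2) by (simp add: T_def D_def xK h_def algebra_simps)
        then have "norm (T q) \<le> e1 * norm (u - x) + e1 * norm (v - x)"
          using 1 norm_triangle_ineq4 by (metis add_mono order_trans)
        also have "\<dots> = e1 * (v - u)" using uv by (simp add: algebra_simps)
        finally show "norm (T q) \<le> e1 * (Sup (snd q) - Inf (snd q))" using uv xK by simp
      qed
      also have "\<dots> \<le> (\<Sum>q\<in>p. e1 * (Sup (snd q) - Inf (snd q)))"
      proof (rule sum_mono2[OF fin])
        show "pG \<subseteq> p" by (auto simp: pG_def)
        fix q assume "q \<in> p - pG"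
        then show "0 \<le> e1 * (Sup (snd q) - Inf (snd q))"
          using K[of "fst q" "snd q"] e1(1) by fastforce
      qed
      also have "\<dots> = e1 * (d - c)"
        by (simp add: len sum_distrib_left case_prod_beta)
      finally have G: "norm (\<Sum>q\<in>pG. T q) < e / 2" using e1(2) by simp
      have pNp: "pN tagged_partial_division_of {a..b}"
      proof -
        have "pN tagged_partial_division_of {c..d}"
          by (rule tagged_partial_division_subset[OF pp]) (simp add: pN_def)
        then show ?thesis
          using cd(2) unfolding tagged_partial_division_of_def by (meson order_trans)
      qed
      have "(\<Sum>(x,K)\<in>pN. measure lborel K) \<le> measure lebesgue U"
      proof (rule tagged_partial_division_content_le[OF pNp Um])
        fix x K assume "(x, K) \<in> pN"
        then have "(x, K) \<in> p" "x \<in> N" by (simp_all add: pN_def)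
        then have "K \<subseteq> \<gamma> x" using fine unfolding fine_def by blast
        then show "K \<subseteq> U" using \<open>x \<in> N\<close> by (simp add: \<gamma>_def)
      qed
      then have "(\<Sum>(x,K)\<in>pN. measure lborel K) < \<delta>" using U\<delta> by simp
      then have "(\<Sum>(x,K)\<in>pN. \<bar>f (Sup K) - f (Inf K)\<bar>) < e / 2"
        by (rule abs_cont_modulus_tagged[OF mod pNp])
      moreover have "norm (\<Sum>q\<in>pN. T q) \<le> (\<Sum>(x,K)\<in>pN. \<bar>f (Sup K) - f (Inf K)\<bar>)"
        by (rule sum_norm_le) (auto simp: T_def D_def h_def pN_def)
      ultimately have "norm (\<Sum>q\<in>pN. T q) < e / 2" by simp
      then show "norm ((\<Sum>(x, K)\<in>p. measure lborel K *\<^sub>R h x) - (f d - f c)) < e"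
        unfolding eq using G norm_triangle_ineq[of "\<Sum>q\<in>pG. T q" "\<Sum>q\<in>pN. T q"] by linarith
    qed
  qed
  then show ?thesis
    unfolding box_real by (rule has_integral_spike[OF N, rotated]) (simp add: h_def)
qed

text \<open>For absolute integrability, the integral over a cell is an increment of
  \<open>f\<close>, dominated by the increment of the variation function \<open>g\<close>; over any
  division the latter telescope to \<open>g b - g a\<close>.\<close>

theorem abs_cont_on_vector_derivative:
  fixes f :: "real \<Rightarrow> real"
  assumes ac: "abs_cont_on a b f" and "a \<le> b"
  defines "f' \<equiv> (\<lambda>t. vector_derivative f (at t within {a..b}))"
  shows "f' absolutely_integrable_on {a..b}"
    and "\<And>t. t \<in> {a..b} \<Longrightarrow> (f' has_integral (f t - f a)) {a..t}"
proof -
  \<comment> \<open>The endpoints are put into \<open>N\<close>, so that elsewhere the derivative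
    within the interval is the two-sided one.\<close>
  define N where "N = {a, b} \<union> {t \<in> {a<..<b}. \<not> f differentiable (at t)}"
  have N: "negligible N"
    unfolding N_def using abs_cont_on_differentiable_ae[OF ac \<open>a \<le> b\<close>]
    by (rule negligible_Un[rotated]) simp
  have int: "(f' has_integral (f d - f c)) {c..d}" if cd: "c \<le> d" "{c..d} \<subseteq> {a..b}" for c d
  proof (rule abs_cont_on_has_integral[OF ac cd N])
    fix t assume t: "t \<in> {c..d} - N"
    then have ab: "a < t" "t < b" "f differentiable (at t)"
      using cd(2) by (auto simp: N_def subset_iff order.order_iff_strict)
    then have "(f has_vector_derivative f' t) (at t)"
      by (simp add: f'_def at_within_Icc_at vector_derivative_works[symmetric])
    then show "(f has_vector_derivative f' t) (at t within {c..d})"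
      by (rule has_vector_derivative_at_within)
  qed
  show "(f' has_integral (f t - f a)) {a..t}" if "t \<in> {a..b}" for t
    using that by (intro int) auto
  obtain g where g: "mono_on {a..b} g" "continuous_on {a..b} g"
    and fg: "\<And>s t. \<lbrakk>a \<le> s; s \<le> t; t \<le> b\<rbrakk> \<Longrightarrow> \<bar>f t - f s\<bar> \<le> g t - g s"
    using abs_cont_on_variation[OF ac] by blast
  have "f' absolutely_integrable_on cbox a b"
  proof (rule bounded_variation_absolutely_integrable_interval)
    show "f' integrable_on cbox a b"
      using int[of a b] \<open>a \<le> b\<close> by (auto simp: has_integral_integrable)
    fix d assume d: "d division_of cbox a b"
    have K: "\<exists>u v. K = {u..v} \<and> u \<le> v \<and> a \<le> u \<and> v \<le> b" if "K \<in> d" for K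
    proof -
      obtain u v where "K = cbox u v" "K \<noteq> {}" "K \<subseteq> cbox a b"
        using division_ofD(2,3,4)[OF d \<open>K \<in> d\<close>] by blast
      then show ?thesis by (intro exI[of _ u] exI[of _ v]) auto
    qed
    \<comment> \<open>The choice of tags is immaterial; tagging makes the telescoping sum over cells
      applicable.\<close>
    define p where "p = (\<lambda>K. (Inf K, K)) ` d"
    have p: "p tagged_division_of {a..b}"
      unfolding tagged_division_of
    proof (intro conjI allI impI)
      show "finite p" using d by (simp add: p_def division_of_finite)
      have "{K. \<exists>x. (x, K) \<in> p} = d" by (auto simp: p_def)
      then show "\<Union>{K. \<exists>x. (x, K) \<in> p} = {a..b}"
        using division_ofD(6)[OF d] by simp
      fix x K assume "(x, K) \<in> p"
      then have xK: "x = Inf K" "K \<in> d" by (auto simp: p_def)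
      then obtain u v where "K = {u..v}" "u \<le> v" "a \<le> u" "v \<le> b" using K by blast
      then show "x \<in> K" "K \<subseteq> {a..b}" "\<exists>u v. K = cbox u v" using xK(1) by auto
    next
      fix x1 K1 x2 K2 assume "(x1, K1) \<in> p \<and> (x2, K2) \<in> p \<and> (x1, K1) \<noteq> (x2, K2)"
      then show "interior K1 \<inter> interior K2 = {}"
        using division_ofD(5)[OF d] by (auto simp: p_def)
    qed
    have "(\<Sum>K\<in>d. norm (integral K f')) \<le> (\<Sum>K\<in>d. g (Sup K) - g (Inf K))"
    proof (rule sum_mono)
      fix K assume "K \<in> d"
      then obtain u v where uv: "K = {u..v}" "u \<le> v" "a \<le> u" "v \<le> b" using K by blast
      then have "integral K f' = f v - f u"
        using int[of u v] by (auto intro: integral_unique)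
      then show "norm (integral K f') \<le> g (Sup K) - g (Inf K)"
        using fg[of u v] uv by simp
    qed
    also have "\<dots> = (\<Sum>(x,K)\<in>p. g (Sup K) - g (Inf K))"
      unfolding p_def by (subst sum.reindex) (auto simp: inj_on_def)
    also have "\<dots> = g b - g a"
      by (rule additive_tagged_division_1[OF \<open>a \<le> b\<close> p])
    finally show "(\<Sum>K\<in>d. norm (integral K f')) \<le> g b - g a" .
  qed
  then show "f' absolutely_integrable_on {a..b}" by simp
qed

section \<open>Fractional integration by parts\<close>

lemma AE_lborel_imp_negligible:
  assumes "AE x in lborel. Q x"
  shows "negligible {x::'a::euclidean_space. \<not> Q x}"
proof -
  obtain N where N: "{x \<in> space lborel. \<not> Q x} \<subseteq> N" "emeasure lborel N = 0" "N \<in> sets lborel"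
    using AE_E[OF assms] .
  have "negligible N"
    using N(2,3) by (simp add: negligible_iff_null_sets null_sets_completionI null_sets_def)
  then show ?thesis by (rule negligible_subset) (use N(1) in simp)
qed

text \<open>Fubini on the product of two copies of \<open>lborel\<close> asks for Borel measurable
  integrands, so a Lebesgue measurable one is replaced by a Borel function equal to it almost
  everywhere.\<close>

lemma absolutely_integrable_borel_representative:
  fixes f :: "real \<Rightarrow> real"
  assumes f: "f absolutely_integrable_on S"
  obtains g where "integrable lborel g" "AE x in lborel. g x = (if x \<in> S then f x else 0)"
proof -
  let ?f = "\<lambda>x. indicator S x *\<^sub>R f x"
  have int: "integrable lebesgue ?f" using f by (simp add: set_integrable_def)
  then obtain g where g: "g \<in> borel_measurable lborel" "AE x in lborel. ?f x = g x"
    using completion_ex_borel_measurable_real[of ?f lborel] by auto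
  have "integrable lebesgue g"
  proof (rule integrable_cong_AE_imp[OF int])
    show "g \<in> borel_measurable lebesgue" using g(1) by (rule measurable_completion)
    show "AE x in lebesgue. ?f x = g x" using g(2) by (rule AE_completion)
  qed
  then have "integrable lborel g" using g(1) by (simp add: integrable_completion)
  moreover have "AE x in lborel. g x = (if x \<in> S then f x else 0)"
    using g(2) by (auto elim!: eventually_mono split: if_splits)
  ultimately show thesis by (rule that)
qed

text \<open>The way back from a Borel representative to the gauge integral of the original
  function.\<close>

lemma has_integral_restrict_AE:
  fixes f g :: "real \<Rightarrow> real"
  assumes g: "integrable lborel g" and eq: "AE x in lborel. g x = (if x \<in> S then f x else 0)"
  shows "(f has_integral (integral\<^sup>L lborel g)) S"
proof -
  have "(g has_integral (integral\<^sup>L lborel g)) UNIV"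
    using g by (rule has_integral_integral_lborel)
  then have "((\<lambda>x. if x \<in> S then f x else 0) has_integral (integral\<^sup>L lborel g)) UNIV"
    by (rule has_integral_spike[OF AE_lborel_imp_negligible[OF eq], rotated]) simp
  then show ?thesis by (simp only: has_integral_restrict_UNIV)
qed

lemma truncated_kernel_integrable:
  fixes \<kappa> :: "real \<Rightarrow> real"
  assumes "\<kappa> \<in> borel_measurable borel" "\<kappa> absolutely_integrable_on {0..c}"
  shows "integrable lborel (\<lambda>s. indicator {0..c} s * \<kappa> s)"
proof -
  have "integrable lebesgue (\<lambda>s. indicator {0..c} s * \<kappa> s)"
    using assms(2) by (simp add: set_integrable_def)
  moreover have "(\<lambda>s. indicator {0..c} s * \<kappa> s) \<in> borel_measurable lborel"
    using assms(1) by measurable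
  ultimately show ?thesis by (simp add: integrable_completion)
qed

lemma integrable_kernel_shift:
  fixes k :: "real \<Rightarrow> real"
  assumes "integrable lborel k"
  shows "integrable lborel (\<lambda>s. k (s - t))" "integral\<^sup>L lborel (\<lambda>s. k (s - t)) = integral\<^sup>L lborel k"
  using lborel_integrable_real_affine[OF assms, of 1 "- t"] lborel_integral_real_affine[of 1 k "- t"]
  by (simp_all add: add.commute)

text \<open>Exchanging the order of integration over the triangle \<open>a \<le> \<tau> \<le> t \<le> b\<close>. The inner integral on the
  left may fail to exist for a null set of \<open>t\<close>.\<close>

lemma Fubini_triangle_kernel:
  fixes \<kappa> u P :: "real \<Rightarrow> real"
  assumes \<kappa>: "\<kappa> \<in> borel_measurable borel" "\<kappa> absolutely_integrable_on {0..b - a}"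
    and u: "u absolutely_integrable_on {a..b}"
    and P: "P absolutely_integrable_on {a..b}" "\<And>t. t \<in> {a..b} \<Longrightarrow> \<bar>P t\<bar> \<le> M"
  obtains I where
    "((\<lambda>t. P t * integral {a..t} (\<lambda>\<tau>. \<kappa> (t - \<tau>) * u \<tau>)) has_integral I) {a..b}"
    "((\<lambda>\<tau>. u \<tau> * integral {\<tau>..b} (\<lambda>s. \<kappa> (s - \<tau>) * P s)) has_integral I) {a..b}"
proof (cases "a \<le> b")
  case False
  then show ?thesis using that[of 0] by (simp add: not_le)
next
  case True
  then have "0 \<le> M" using P(2)[of a] abs_ge_zero order_trans by fastforce
  \<comment> \<open>The cutoff makes \<open>k (t - \<tau>)\<close> vanish for
    \<open>t < \<tau>\<close>, so integration over the triangle becomes integration over the plane,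
    with \<open>k\<close> integrable on the whole line.\<close>
  define k where "k = (\<lambda>s. indicator {0..b - a} s * \<kappa> s)"
  have k: "integrable lborel k" unfolding k_def by (rule truncated_kernel_integrable[OF \<kappa>])
  note k_meas [measurable] = borel_measurable_integrable[OF k]
  obtain u' where u': "integrable lborel u'" "AE x in lborel. u' x = (if x \<in> {a..b} then u x else 0)"
    using absolutely_integrable_borel_representative[OF u] .
  note u'_meas [measurable] = borel_measurable_integrable[OF u'(1)]
  obtain P0 where P0: "integrable lborel P0" "AE x in lborel. P0 x = (if x \<in> {a..b} then P x else 0)"
    using absolutely_integrable_borel_representative[OF P(1)] .
  note P0_meas [measurable] = borel_measurable_integrable[OF P0(1)]
  \<comment> \<open>\<open>P0\<close> inherits the bound \<open>M\<close> only almost everywhere.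
    Clamping makes it hold everywhere and alters \<open>P0\<close> only on a null set.\<close>
  define P' where "P' = (\<lambda>x. max (- M) (min M (P0 x)))"
  have P'_meas [measurable]: "P' \<in> borel_measurable lborel"
    unfolding P'_def by measurable
  have P': "AE x in lborel. P' x = (if x \<in> {a..b} then P x else 0)"
    using P0(2)
  proof (rule eventually_mono)
    fix x assume "P0 x = (if x \<in> {a..b} then P x else 0)"
    then show "P' x = (if x \<in> {a..b} then P x else 0)"
      using P(2)[of x] \<open>0 \<le> M\<close> by (auto simp: P'_def abs_le_iff)
  qed
  have P'_le: "\<bar>P' x\<bar> \<le> M" for x
    using \<open>0 \<le> M\<close> by (auto simp: P'_def)
  define f where "f = (\<lambda>\<tau> t. u' \<tau> * (k (t - \<tau>) * P' t))"
  have f_meas [measurable]: "case_prod f \<in> borel_measurable (lborel \<Otimes>\<^sub>M lborel)"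
    unfolding f_def by measurable
  have int_kP: "integrable lborel (\<lambda>t. k (t - \<tau>) * P' t)"
    and bound_kP: "(\<integral>t. \<bar>k (t - \<tau>) * P' t\<bar> \<partial>lborel) \<le> M * (\<integral>t. \<bar>k t\<bar> \<partial>lborel)" for \<tau>
  proof -
    have ka: "integrable lborel (\<lambda>t. \<bar>k (t - \<tau>)\<bar>)" "(\<integral>t. \<bar>k (t - \<tau>)\<bar> \<partial>lborel) = (\<integral>t. \<bar>k t\<bar> \<partial>lborel)"
      using integrable_kernel_shift[of "\<lambda>t. \<bar>k t\<bar>" \<tau>] k by simp_all
    have le: "\<bar>k (t - \<tau>) * P' t\<bar> \<le> M * \<bar>k (t - \<tau>)\<bar>" for t
      using mult_left_mono[OF P'_le[of t] abs_ge_zero[of "k (t - \<tau>)"]] by (simp add: abs_mult mult.commute)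
    show int: "integrable lborel (\<lambda>t. k (t - \<tau>) * P' t)"
      by (rule Bochner_Integration.integrable_bound[where f = "\<lambda>t. M * \<bar>k (t - \<tau>)\<bar>"])
        (use ka order_trans[OF le abs_ge_self] in \<open>auto intro!: AE_I2\<close>)
    have "(\<integral>t. \<bar>k (t - \<tau>) * P' t\<bar> \<partial>lborel) \<le> (\<integral>t. M * \<bar>k (t - \<tau>)\<bar> \<partial>lborel)"
      by (rule integral_mono) (use int ka le in auto)
    then show "(\<integral>t. \<bar>k (t - \<tau>) * P' t\<bar> \<partial>lborel) \<le> M * (\<integral>t. \<bar>k t\<bar> \<partial>lborel)"
      using ka by simp
  qed
  \<comment> \<open>Tonelli: for fixed \<open>\<tau>\<close> the integral of the absolute value over
    \<open>t\<close> is at most a constant times \<open>\<bar>u' \<tau>\<bar>\<close>, which is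
    integrable.\<close>
  have f_int: "integrable (lborel \<Otimes>\<^sub>M lborel) (case_prod f)"
  proof (rule lborel_pair.Fubini_integrable[OF f_meas])
    have eq: "(\<integral>t. norm (case (\<tau>, t) of (\<tau>, t) \<Rightarrow> f \<tau> t) \<partial>lborel) =
        \<bar>u' \<tau>\<bar> * (\<integral>t. \<bar>k (t - \<tau>) * P' t\<bar> \<partial>lborel)" for \<tau>
      by (simp add: f_def abs_mult)
    show "integrable lborel (\<lambda>\<tau>. \<integral>t. norm (case (\<tau>, t) of (\<tau>, t) \<Rightarrow> f \<tau> t) \<partial>lborel)"
    proof (rule Bochner_Integration.integrable_bound)
      show "integrable lborel (\<lambda>\<tau>. \<bar>u' \<tau>\<bar> * (M * (\<integral>t. \<bar>k t\<bar> \<partial>lborel)))"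
        using u'(1) by simp
      show "(\<lambda>\<tau>. \<integral>t. norm (case (\<tau>, t) of (\<tau>, t) \<Rightarrow> f \<tau> t) \<partial>lborel) \<in> borel_measurable lborel"
        by measurable
      have "norm (\<integral>t. norm (case (\<tau>, t) of (\<tau>, t) \<Rightarrow> f \<tau> t) \<partial>lborel) \<le>
          norm (\<bar>u' \<tau>\<bar> * (M * (\<integral>t. \<bar>k t\<bar> \<partial>lborel)))" for \<tau>
        unfolding eq using mult_left_mono[OF bound_kP[of \<tau>] abs_ge_zero[of "u' \<tau>"]]
        using \<open>0 \<le> M\<close> by (simp add: abs_mult)
      then show "AE \<tau> in lborel. norm (\<integral>t. norm (case (\<tau>, t) of (\<tau>, t) \<Rightarrow> f \<tau> t) \<partial>lborel) \<le>
          norm (\<bar>u' \<tau>\<bar> * (M * (\<integral>t. \<bar>k t\<bar> \<partial>lborel)))"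
        by simp
    qed
    show "AE \<tau> in lborel. integrable lborel (\<lambda>t. case (\<tau>, t) of (\<tau>, t) \<Rightarrow> f \<tau> t)"
      using int_kP by (simp add: f_def)
  qed
  define I where "I = (\<integral>\<tau>. (\<integral>t. f \<tau> t \<partial>lborel) \<partial>lborel)"
  have I: "(\<integral>t. (\<integral>\<tau>. f \<tau> t \<partial>lborel) \<partial>lborel) = I"
    unfolding I_def by (rule lborel_pair.Fubini_integral[OF f_int])
  have right: "(\<integral>t. f \<tau> t \<partial>lborel) = u' \<tau> * integral {\<tau>..b} (\<lambda>s. \<kappa> (s - \<tau>) * P s)"
    if \<tau>: "\<tau> \<in> {a..b}" for \<tau>
  proof -
    have "((\<lambda>s. \<kappa> (s - \<tau>) * P s) has_integral (\<integral>t. k (t - \<tau>) * P' t \<partial>lborel)) {\<tau>..b}"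
    proof (rule has_integral_restrict_AE[OF int_kP])
      show "AE t in lborel. k (t - \<tau>) * P' t = (if t \<in> {\<tau>..b} then \<kappa> (t - \<tau>) * P t else 0)"
        using P'
      proof (rule eventually_mono)
        fix t assume "P' t = (if t \<in> {a..b} then P t else 0)"
        then show "k (t - \<tau>) * P' t = (if t \<in> {\<tau>..b} then \<kappa> (t - \<tau>) * P t else 0)"
          using \<tau> by (auto simp: k_def indicator_def)
      qed
    qed
    then show ?thesis by (simp add: f_def integral_unique)
  qed
  have left: "(\<integral>\<tau>. f \<tau> t \<partial>lborel) = P' t * integral {a..t} (\<lambda>\<tau>. \<kappa> (t - \<tau>) * u \<tau>)"
    if t: "t \<in> {a..b}" and int: "integrable lborel (\<lambda>\<tau>. f \<tau> t)" for t
  \<comment> \<open>If \<open>P' t = 0\<close>, both sides vanish whatever the inner integral is.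
    Otherwise integrability of \<open>f\<close> in \<open>\<tau>\<close> passes to the factor
    \<open>k (t - \<tau>) * u' \<tau>\<close>.\<close>
  proof (cases "P' t = 0")
    case True
    then show ?thesis by (simp add: f_def)
  next
    case False
    have "(\<lambda>\<tau>. f \<tau> t) = (\<lambda>\<tau>. (k (t - \<tau>) * u' \<tau>) * P' t)"
      by (simp add: f_def mult_ac)
    then have int': "integrable lborel (\<lambda>\<tau>. k (t - \<tau>) * u' \<tau>)"
      using int False by simp
    have "((\<lambda>\<tau>. \<kappa> (t - \<tau>) * u \<tau>) has_integral (\<integral>\<tau>. k (t - \<tau>) * u' \<tau> \<partial>lborel)) {a..t}"
    proof (rule has_integral_restrict_AE[OF int'])
      show "AE \<tau> in lborel. k (t - \<tau>) * u' \<tau> = (if \<tau> \<in> {a..t} then \<kappa> (t - \<tau>) * u \<tau> else 0)"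
        using u'(2)
      proof (rule eventually_mono)
        fix \<tau> assume "u' \<tau> = (if \<tau> \<in> {a..b} then u \<tau> else 0)"
        then show "k (t - \<tau>) * u' \<tau> = (if \<tau> \<in> {a..t} then \<kappa> (t - \<tau>) * u \<tau> else 0)"
          using t by (auto simp: k_def indicator_def)
      qed
    qed
    then have "integral {a..t} (\<lambda>\<tau>. \<kappa> (t - \<tau>) * u \<tau>) = (\<integral>\<tau>. k (t - \<tau>) * u' \<tau> \<partial>lborel)"
      by (rule integral_unique)
    moreover have "(\<integral>\<tau>. f \<tau> t \<partial>lborel) = P' t * (\<integral>\<tau>. k (t - \<tau>) * u' \<tau> \<partial>lborel)"
      unfolding f_def by (subst integral_mult_right_zero[symmetric]) (simp add: mult_ac)
    ultimately show ?thesis by simp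
  qed
  show thesis
  proof (rule that)
    have AE: "AE t in lborel. integrable lborel (\<lambda>\<tau>. f \<tau> t)"
      by (rule lborel_pair.AE_integrable_snd[OF f_int])
    have "AE t in lborel. (\<integral>\<tau>. f \<tau> t \<partial>lborel) =
        (if t \<in> {a..b} then P t * integral {a..t} (\<lambda>\<tau>. \<kappa> (t - \<tau>) * u \<tau>) else 0)"
      using AE P'
    proof (rule eventually_elim2)
      fix t assume t: "integrable lborel (\<lambda>\<tau>. f \<tau> t)" "P' t = (if t \<in> {a..b} then P t else 0)"
      show "(\<integral>\<tau>. f \<tau> t \<partial>lborel) =
          (if t \<in> {a..b} then P t * integral {a..t} (\<lambda>\<tau>. \<kappa> (t - \<tau>) * u \<tau>) else 0)"
      proof (cases "t \<in> {a..b}")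
        case True
        then show ?thesis using left[OF True t(1)] t(2) by simp
      next
        case False
        then have "P' t = 0" using t(2) by (simp only: if_False)
        then show ?thesis using False by (auto simp: f_def)
      qed
    qed
    from has_integral_restrict_AE[OF lborel_pair.integrable_snd[OF f_int] this]
    show "((\<lambda>t. P t * integral {a..t} (\<lambda>\<tau>. \<kappa> (t - \<tau>) * u \<tau>)) has_integral I) {a..b}"
      by (simp only: I)
    have "AE \<tau> in lborel. (\<integral>t. f \<tau> t \<partial>lborel) =
        (if \<tau> \<in> {a..b} then u \<tau> * integral {\<tau>..b} (\<lambda>s. \<kappa> (s - \<tau>) * P s) else 0)"
      using u'(2)
    proof (rule eventually_mono)
      fix \<tau> assume \<tau>: "u' \<tau> = (if \<tau> \<in> {a..b} then u \<tau> else 0)"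
      show "(\<integral>t. f \<tau> t \<partial>lborel) =
          (if \<tau> \<in> {a..b} then u \<tau> * integral {\<tau>..b} (\<lambda>s. \<kappa> (s - \<tau>) * P s) else 0)"
      proof (cases "\<tau> \<in> {a..b}")
        case True
        then show ?thesis using right[OF True] \<tau> by simp
      next
        case False
        then have "u' \<tau> = 0" using \<tau> by (simp only: if_False)
        then show ?thesis using False by (auto simp: f_def)
      qed
    qed
    from has_integral_restrict_AE[OF lborel_pair.integrable_fst[OF f_int] this]
    show "((\<lambda>\<tau>. u \<tau> * integral {\<tau>..b} (\<lambda>s. \<kappa> (s - \<tau>) * P s)) has_integral I) {a..b}"
      by (simp only: I_def)
  qed
qed

text \<open>The bound is uniform in \<open>t\<close>, since every shifted range of integration lies
  inside \<open>{0..b - a}\<close>.\<close>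

lemma integrable_kernel_product:
  fixes \<kappa> P :: "real \<Rightarrow> real"
  assumes \<kappa>: "\<kappa> \<in> borel_measurable borel" "\<kappa> absolutely_integrable_on {0..b - a}"
    and P: "continuous_on {a..b} P" "\<And>s. s \<in> {a..b} \<Longrightarrow> \<bar>P s\<bar> \<le> M"
    and t: "t \<in> {a..b}"
  shows "(\<lambda>s. \<kappa> (s - t) * P s) integrable_on {t..b}"
    and "\<bar>integral {t..b} (\<lambda>s. \<kappa> (s - t) * P s)\<bar> \<le> M * integral {0..b - a} (\<lambda>s. \<bar>\<kappa> s\<bar>)"
proof -
  define k where "k = (\<lambda>s. indicator {0..b - a} s * \<kappa> s)"
  have k: "integrable lborel k" unfolding k_def by (rule truncated_kernel_integrable[OF \<kappa>])
  then have ks: "integrable lborel (\<lambda>s. k (s - t))" by (rule integrable_kernel_shift)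
  have "(\<lambda>s. k (s - t)) absolutely_integrable_on UNIV"
    using ks by (simp add: set_integrable_def integrable_completion borel_measurable_integrable)
  then have "(\<lambda>s. k (s - t)) absolutely_integrable_on {t..b}"
    by (rule set_integrable_subset) auto
  moreover have eq: "k (s - t) = \<kappa> (s - t)" if "s \<in> {t..b}" for s
    using that t by (auto simp: k_def)
  ultimately have ai: "(\<lambda>s. \<kappa> (s - t)) absolutely_integrable_on {t..b}"
    by (subst set_integrable_cong[OF refl refl, where f' = "\<lambda>s. k (s - t)"]) auto
  have cont: "continuous_on {t..b} P" using P(1) t by (auto intro: continuous_on_subset)
  have "(\<lambda>s. P s * \<kappa> (s - t)) absolutely_integrable_on {t..b}"
  proof (rule absolutely_integrable_bounded_measurable_product_real[OF _ _ _ ai])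
    show "P \<in> borel_measurable (lebesgue_on {t..b})"
      using cont by (rule continuous_imp_measurable_on_sets_lebesgue) simp
    show "bounded (P ` {t..b})" using compact_continuous_image[OF cont] by (simp add: compact_imp_bounded)
  qed simp
  then have "(\<lambda>s. \<kappa> (s - t) * P s) absolutely_integrable_on {t..b}"
    by (simp add: mult.commute)
  then show int: "(\<lambda>s. \<kappa> (s - t) * P s) integrable_on {t..b}"
    by (simp add: set_lebesgue_integral_eq_integral)
  have "0 \<le> M" using P(2)[OF t] by linarith
  have ka: "integrable lborel (\<lambda>s. \<bar>k (s - t)\<bar>)" using ks by simp
  have kU: "((\<lambda>s. \<bar>k (s - t)\<bar>) has_integral (\<integral>s. \<bar>k s\<bar> \<partial>lborel)) UNIV"
    using has_integral_integral_lborel[OF ka] integrable_kernel_shift(2)[of "\<lambda>s. \<bar>k s\<bar>" t] k by simp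
  have kb: "(\<lambda>s. \<bar>k (s - t)\<bar>) integrable_on {t..b}"
    using kU by (intro integrable_on_subinterval[of _ UNIV]) (auto simp: has_integral_integrable)
  have "norm (integral {t..b} (\<lambda>s. \<kappa> (s - t) * P s)) \<le> integral {t..b} (\<lambda>s. M * \<bar>k (s - t)\<bar>)"
  proof (rule integral_norm_bound_integral[OF int])
    show "(\<lambda>s. M * \<bar>k (s - t)\<bar>) integrable_on {t..b}"
      using integrable_on_cmult_left[OF kb, of M] by simp
    fix s assume s: "s \<in> {t..b}"
    then have "\<bar>P s\<bar> \<le> M" using P(2) t by simp
    from mult_right_mono[OF this abs_ge_zero[of "\<kappa> (s - t)"]]
    show "norm (\<kappa> (s - t) * P s) \<le> M * \<bar>k (s - t)\<bar>"
      using eq[OF s] by (simp add: abs_mult mult.commute)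
  qed
  also have "\<dots> = M * integral {t..b} (\<lambda>s. \<bar>k (s - t)\<bar>)" by simp
  also have "integral {t..b} (\<lambda>s. \<bar>k (s - t)\<bar>) \<le> integral UNIV (\<lambda>s. \<bar>k (s - t)\<bar>)"
    using kU by (intro integral_subset_le kb) (auto simp: has_integral_integrable)
  also have "integral UNIV (\<lambda>s. \<bar>k (s - t)\<bar>) = (\<integral>s. \<bar>k s\<bar> \<partial>lborel)"
    using kU by (rule integral_unique)
  also have "(\<integral>s. \<bar>k s\<bar> \<partial>lborel) = integral {0..b - a} (\<lambda>s. \<bar>\<kappa> s\<bar>)"
  proof -
    have "((\<lambda>s. \<bar>\<kappa> s\<bar>) has_integral (\<integral>s. \<bar>k s\<bar> \<partial>lborel)) {0..b - a}"
      using k by (intro has_integral_restrict_AE) (auto simp: k_def)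
    then show ?thesis by (simp add: integral_unique)
  qed
  finally show "\<bar>integral {t..b} (\<lambda>s. \<kappa> (s - t) * P s)\<bar> \<le> M * integral {0..b - a} (\<lambda>s. \<bar>\<kappa> s\<bar>)"
    using \<open>0 \<le> M\<close> by (simp add: mult_left_mono)
qed

section \<open>Riemann-Liouville integrals and their adjointness\<close>

lemma powr_kernel:
  fixes \<gamma> c :: real
  assumes "0 < \<gamma>"
  shows "(\<lambda>s. s powr (\<gamma> - 1)) \<in> borel_measurable borel"
    and "(\<lambda>s. s powr (\<gamma> - 1)) absolutely_integrable_on {0..c}"
proof -
  show "(\<lambda>s::real. s powr (\<gamma> - 1)) \<in> borel_measurable borel" by measurable
  show "(\<lambda>s. s powr (\<gamma> - 1)) absolutely_integrable_on {0..c}"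
  proof (cases "0 \<le> c")
    case True
    then have "(\<lambda>s. s powr (\<gamma> - 1)) integrable_on {0..c}"
      using has_integral_powr_from_0[of "\<gamma> - 1" c] assms by (auto simp: has_integral_integrable)
    then show ?thesis by (intro nonnegative_absolutely_integrable_1) auto
  qed (simp add: absolutely_integrable_on_def)
qed

lemma continuous_on_Icc_bounded:
  fixes f :: "real \<Rightarrow> real"
  assumes "continuous_on {a..b} f"
  shows "\<exists>M. \<forall>t\<in>{a..b}. \<bar>f t\<bar> \<le> M"
proof -
  have "bounded (f ` {a..b})"
    using compact_continuous_image[OF assms] by (simp add: compact_imp_bounded)
  then show ?thesis by (simp add: bounded_iff)
qed

text \<open>Fubini for the power kernel. A common value \<open>I\<close> records the existence of
  both integrals along with their equality.\<close>

lemma lRL_int_adjoint: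
  assumes "0 < \<gamma>" and u: "u absolutely_integrable_on {a..b}" and P: "continuous_on {a..b} P"
  obtains I where "((\<lambda>t. P t * lRL_int \<gamma> a u t) has_integral I) {a..b}"
    "((\<lambda>t. u t * rRL_int \<gamma> b P t) has_integral I) {a..b}"
proof -
  obtain M where M: "\<forall>t\<in>{a..b}. \<bar>P t\<bar> \<le> M"
    using continuous_on_Icc_bounded[OF P] by (elim exE)
  have "P absolutely_integrable_on {a..b}"
    using P by (rule absolutely_integrable_continuous_real)
  then obtain I where I:
    "((\<lambda>t. P t * integral {a..t} (\<lambda>\<tau>. (t - \<tau>) powr (\<gamma> - 1) * u \<tau>)) has_integral I) {a..b}"
    "((\<lambda>\<tau>. u \<tau> * integral {\<tau>..b} (\<lambda>s. (s - \<tau>) powr (\<gamma> - 1) * P s)) has_integral I) {a..b}"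
    using M by (elim Fubini_triangle_kernel[where P = P and u = u, OF powr_kernel[OF \<open>0 < \<gamma>\<close>] u]) auto
  show thesis
  proof (rule that)
    show "((\<lambda>t. P t * lRL_int \<gamma> a u t) has_integral (1 / Gamma \<gamma>) * I) {a..b}"
      using has_integral_mult_right[OF I(1), of "1 / Gamma \<gamma>"] by (simp add: lRL_int_def mult_ac)
    show "((\<lambda>t. u t * rRL_int \<gamma> b P t) has_integral (1 / Gamma \<gamma>) * I) {a..b}"
      using has_integral_mult_right[OF I(2), of "1 / Gamma \<gamma>"] by (simp add: rRL_int_def mult_ac)
  qed
qed

lemma rRL_int_integrable:
  fixes P :: "real \<Rightarrow> real"
  assumes "0 < \<gamma>" and P: "continuous_on {a..b} P" and t: "t \<in> {a..b}"
  shows "(\<lambda>s. (s - t) powr (\<gamma> - 1) * P s) integrable_on {t..b}"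
proof -
  obtain M where M: "\<forall>t\<in>{a..b}. \<bar>P t\<bar> \<le> M"
    using continuous_on_Icc_bounded[OF P] by (elim exE)
  show ?thesis
    using integrable_kernel_product(1)[where P = P, OF powr_kernel[OF assms(1)] P M[rule_format] t] .
qed

text \<open>Provides the bound on the derivative that the integration by parts asks for.\<close>

lemma rRL_int_bounded:
  assumes "0 < \<gamma>" and P: "continuous_on {a..b} P"
  shows "\<exists>C. \<forall>t\<in>{a..b}. \<bar>rRL_int \<gamma> b P t\<bar> \<le> C"
proof -
  obtain M where M: "\<forall>t\<in>{a..b}. \<bar>P t\<bar> \<le> M"
    using continuous_on_Icc_bounded[OF P] by (elim exE)
  define C where "C = M * integral {0..b - a} (\<lambda>s. \<bar>s powr (\<gamma> - 1)\<bar>)"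
  have "\<bar>rRL_int \<gamma> b P t\<bar> \<le> \<bar>1 / Gamma \<gamma>\<bar> * C" if "t \<in> {a..b}" for t
    unfolding rRL_int_def abs_mult C_def
    by (rule mult_left_mono[OF integrable_kernel_product(2)[where P = P,
          OF powr_kernel[OF assms(1)] P M[rule_format] that]]) auto
  then show ?thesis by blast
qed

lemma rRL_int_add:
  assumes "0 < \<gamma>" "continuous_on {a..b} P" "continuous_on {a..b} Q" "t \<in> {a..b}"
  shows "rRL_int \<gamma> b (\<lambda>s. P s + Q s) t = rRL_int \<gamma> b P t + rRL_int \<gamma> b Q t"
  using integral_add[OF rRL_int_integrable[OF assms(1,2,4)] rRL_int_integrable[OF assms(1,3,4)]]
  by (simp add: rRL_int_def distrib_left)

lemma lRL_int_diff:
  assumes "(\<lambda>\<tau>. (t - \<tau>) powr (\<gamma> - 1) * u \<tau>) integrable_on {a..t}"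
    and "(\<lambda>\<tau>. (t - \<tau>) powr (\<gamma> - 1) * v \<tau>) integrable_on {a..t}"
  shows "lRL_int \<gamma> a (\<lambda>\<tau>. u \<tau> - v \<tau>) t = lRL_int \<gamma> a u t - lRL_int \<gamma> a v t"
  using integral_diff[OF assms] by (simp add: lRL_int_def right_diff_distrib)

text \<open>Since \<open>- \<alpha> = (1 - \<alpha>) - 1\<close>, the Euler-Lagrange equation and
  the natural boundary condition concern the same fractional integral.\<close>

lemma rRL_kernel_eq_rRL_int: "rRL_kernel \<alpha> b = rRL_int (1 - \<alpha>) b"
  by (intro ext) (simp add: rRL_kernel_def rRL_int_def)

text \<open>Through this form the adjointness of fractional integrals moves the Caputo derivative as
  well.\<close>

lemma lCaputo_eq_lRL_int:
  "lCaputo \<alpha> a b x = lRL_int (1 - \<alpha>) a (\<lambda>\<tau>. vector_derivative x (at \<tau> within {a..b}))"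
  by (intro ext) (simp add: lCaputo_def lRL_int_def)

section \<open>Integration by parts and the first variation\<close>

lemma integral_triangle_swap:
  fixes u P :: "real \<Rightarrow> real"
  assumes u: "u absolutely_integrable_on {a..b}"
    and P: "P absolutely_integrable_on {a..b}" "\<And>t. t \<in> {a..b} \<Longrightarrow> \<bar>P t\<bar> \<le> M"
  obtains I where "((\<lambda>t. P t * integral {a..t} u) has_integral I) {a..b}"
    "((\<lambda>t. u t * integral {t..b} P) has_integral I) {a..b}"
proof -
  have k: "(\<lambda>_::real. 1::real) \<in> borel_measurable borel"
    "(\<lambda>_::real. 1::real) absolutely_integrable_on {0..b - a}"
    by (auto intro: absolutely_integrable_continuous_real)
  show thesis
    using Fubini_triangle_kernel[where P = P and u = u, OF k u P, simplified] that by metis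
qed

text \<open>Both functions are recovered from their derivatives, so the formula is a triangle swap:
  \<open>h t - h a\<close> is the integral of \<open>u\<close> up to \<open>t\<close>, and
  \<open>- K t\<close> is the integral of \<open>k\<close> from \<open>t\<close> on.\<close>

lemma integration_by_parts_vanishing_ends:
  fixes u h k K :: "real \<Rightarrow> real"
  assumes ab: "a \<le> b"
    and u: "u absolutely_integrable_on {a..b}"
    and h: "\<And>t. t \<in> {a..b} \<Longrightarrow> (u has_integral (h t - h a)) {a..t}"
    and K: "\<And>t. t \<in> {a..b} \<Longrightarrow> (K has_vector_derivative k t) (at t within {a..b})"
    and k: "\<And>t. t \<in> {a..b} \<Longrightarrow> \<bar>k t\<bar> \<le> M"
    and ends: "K a = 0" "K b = 0"
  obtains I where "((\<lambda>t. k t * h t) has_integral - I) {a..b}" "((\<lambda>t. u t * K t) has_integral I) {a..b}"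
proof -
  have kK: "(k has_integral (K b - K t)) {t..b}" if "t \<in> {a..b}" for t
    using that by (intro fundamental_theorem_of_calculus has_vector_derivative_within_subset[OF K]) auto
  have k0: "(k has_integral 0) {a..b}" using kK[of a] ab ends by simp
  have "k absolutely_integrable_on {a..b}"
  proof (rule absolutely_integrable_integrable_bound)
    show "k integrable_on {a..b}" using k0 by (rule has_integral_integrable)
    show "norm (k t) \<le> M" if "t \<in> {a..b}" for t using k[OF that] by simp
  qed (rule integrable_const_ivl)
  then obtain I where I: "((\<lambda>t. k t * integral {a..t} u) has_integral I) {a..b}"
    "((\<lambda>t. u t * integral {t..b} k) has_integral I) {a..b}"
    using integral_triangle_swap[where P = k and u = u, OF u _ k] by metis
  have 1: "((\<lambda>t. k t * (h t - h a)) has_integral I) {a..b}"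
    using I(1) by (rule has_integral_eq[rotated]) (use integral_unique[OF h] in simp)
  have 2: "((\<lambda>t. u t * - K t) has_integral I) {a..b}"
    using I(2) by (rule has_integral_eq[rotated]) (use integral_unique[OF kK] ends in simp)
  show thesis
  proof (rule that[of "- I"])
    show "((\<lambda>t. u t * K t) has_integral - I) {a..b}" using has_integral_neg[OF 2] by simp
    \<comment> \<open>The constant \<open>h a\<close> drops out because \<open>k\<close> has
      integral zero, \<open>K\<close> vanishing at both ends.\<close>
    show "((\<lambda>t. k t * h t) has_integral - (- I)) {a..b}"
      using has_integral_add[OF 1 has_integral_mult_left[OF k0, of "h a"]]
      by (simp add: algebra_simps)
  qed
qed

lemma FFD:
  assumes "x \<in> FF \<alpha> \<beta> a b"
  shows "abs_cont_on a b x" "continuous_on {a..b} x"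
    "continuous_on {a..b} (lCaputo \<alpha> a b x)" "continuous_on {a..b} (lRL_int \<beta> a x)"
  using assms by (simp_all add: FF_def abs_cont_on_imp_continuous_on)

text \<open>Adjointness turns the \<open>P\<close> term into the integral of \<open>u * K\<close>
  and the \<open>Q\<close> term into that of \<open>h * R\<close>. As \<open>K\<close> has
  derivative \<open>A + R\<close>, integration by parts cancels the integral of \<open>u * K\<close>
  against that of \<open>(A + R) * h\<close>.\<close>

lemma first_variation_has_integral_zero:
  fixes A P Q :: "real \<Rightarrow> real"
  assumes \<alpha>: "0 < \<alpha>" "\<alpha> < 1" and \<beta>: "0 < \<beta>" and ab: "a \<le> b"
    and x: "x \<in> FF \<alpha> \<beta> a b" and y: "y \<in> FF \<alpha> \<beta> a b"
    and A: "continuous_on {a..b} A" and P: "continuous_on {a..b} P" and Q: "continuous_on {a..b} Q"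
    and K: "\<And>t. t \<in> {a..b} \<Longrightarrow> (rRL_int (1 - \<alpha>) b P has_vector_derivative
              (A t + rRL_int \<beta> b Q t)) (at t within {a..b})"
    and Ka: "rRL_int (1 - \<alpha>) b P a = 0"
  shows "((\<lambda>t. A t * (y t - x t) + P t * (lCaputo \<alpha> a b y t - lCaputo \<alpha> a b x t)
            + Q t * (lRL_int \<beta> a y t - lRL_int \<beta> a x t)) has_integral 0) {a..b}"
proof -
  define x' where "x' = (\<lambda>\<tau>. vector_derivative x (at \<tau> within {a..b}))"
  define y' where "y' = (\<lambda>\<tau>. vector_derivative y (at \<tau> within {a..b}))"
  define u where "u = (\<lambda>\<tau>. y' \<tau> - x' \<tau>)"
  define h where "h = (\<lambda>t. y t - x t)"
  define K where "K = rRL_int (1 - \<alpha>) b P"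
  define R where "R = rRL_int \<beta> b Q"
  define k where "k = (\<lambda>t. A t + R t)"
  note acx = abs_cont_on_vector_derivative[OF FFD(1)[OF x] ab, folded x'_def]
  note acy = abs_cont_on_vector_derivative[OF FFD(1)[OF y] ab, folded y'_def]
  have u: "u absolutely_integrable_on {a..b}"
    unfolding u_def by (rule set_integral_diff(1)[OF acy(1) acx(1)])
  have uh: "(u has_integral (h t - h a)) {a..t}" if "t \<in> {a..b}" for t
    using has_integral_diff[OF acy(2)[OF that] acx(2)[OF that]]
    by (simp add: u_def h_def algebra_simps)
  have h: "continuous_on {a..b} h" unfolding h_def by (intro continuous_intros FFD(2)[OF x] FFD(2)[OF y])
  \<comment> \<open>Linearity at every single \<open>t\<close>, not just almost every one, rests on
    the integrability clauses of \<open>FF\<close>.\<close>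
  have D: "lRL_int (1 - \<alpha>) a u t = lCaputo \<alpha> a b y t - lCaputo \<alpha> a b x t" if "t \<in> {a..b}" for t
    unfolding u_def lCaputo_eq_lRL_int x'_def y'_def
    using x y that by (intro lRL_int_diff) (simp_all add: FF_def)
  have I: "lRL_int \<beta> a h t = lRL_int \<beta> a y t - lRL_int \<beta> a x t" if "t \<in> {a..b}" for t
    unfolding h_def using x y that by (intro lRL_int_diff) (simp_all add: FF_def)
  obtain I1 where I1: "((\<lambda>t. P t * lRL_int (1 - \<alpha>) a u t) has_integral I1) {a..b}"
    "((\<lambda>t. u t * K t) has_integral I1) {a..b}"
    unfolding K_def using lRL_int_adjoint[OF _ u P, of "1 - \<alpha>"] \<alpha> by auto
  obtain I2 where I2: "((\<lambda>t. Q t * lRL_int \<beta> a h t) has_integral I2) {a..b}"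
    "((\<lambda>t. h t * R t) has_integral I2) {a..b}"
    unfolding R_def by (rule lRL_int_adjoint[OF \<beta> absolutely_integrable_continuous_real[OF h] Q])
  have "continuous_on {a..b} (\<lambda>t. A t * h t)" by (intro continuous_intros A h)
  then obtain I3 where I3: "((\<lambda>t. A t * h t) has_integral I3) {a..b}"
    using integrable_continuous_real unfolding integrable_on_def by blast
  obtain MA where MA: "\<forall>t\<in>{a..b}. \<bar>A t\<bar> \<le> MA"
    using continuous_on_Icc_bounded[OF A] by (elim exE)
  obtain MR where MR: "\<forall>t\<in>{a..b}. \<bar>R t\<bar> \<le> MR"
    unfolding R_def using rRL_int_bounded[OF \<beta> Q] by (elim exE)
  have kM: "\<bar>k t\<bar> \<le> MA + MR" if "t \<in> {a..b}" for t
    using MA[rule_format, OF that] MR[rule_format, OF that] by (simp add: k_def)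
  have Kder: "(K has_vector_derivative k t) (at t within {a..b})" if "t \<in> {a..b}" for t
    unfolding K_def k_def R_def by (rule assms(10)[OF that])
  have Kb: "K b = 0" by (simp add: K_def rRL_int_def)
  obtain J where J: "((\<lambda>t. k t * h t) has_integral - J) {a..b}" "((\<lambda>t. u t * K t) has_integral J) {a..b}"
    using integration_by_parts_vanishing_ends[where u = u and h = h and K = K and k = k,
        OF ab u uh Kder kM Ka[folded K_def] Kb] by metis
  have "((\<lambda>t. k t * h t) has_integral I3 + I2) {a..b}"
    using has_integral_add[OF I3 I2(2)] by (simp add: k_def algebra_simps)
  then have "I3 + I2 = - J" using J(1) by (rule has_integral_unique)
  moreover have "I1 = J" using I1(2) J(2) by (rule has_integral_unique)
  moreover have "((\<lambda>t. A t * h t + P t * lRL_int (1 - \<alpha>) a u t + Q t * lRL_int \<beta> a h t)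
      has_integral I3 + I1 + I2) {a..b}"
    by (intro has_integral_add I1 I2 I3)
  moreover have "I3 + J + I2 = 0" using \<open>I3 + I2 = - J\<close> by simp
  ultimately have "((\<lambda>t. A t * h t + P t * lRL_int (1 - \<alpha>) a u t + Q t * lRL_int \<beta> a h t)
      has_integral 0) {a..b}" by simp
  then show ?thesis
    by (rule has_integral_eq[rotated]) (simp only: D I, simp add: h_def)
qed

section \<open>Sufficiency of the Euler-Lagrange equation\<close>

lemma C1_with_partials5_continuous:
  assumes "C1_with_partials5 F Ft Fx Fv Fw Fz"
  shows "continuous_on UNIV F" "continuous_on UNIV Fx" "continuous_on UNIV Fv"
    "continuous_on UNIV Fw" "continuous_on UNIV Fz"
proof -
  show "continuous_on UNIV F"
    using assms unfolding C1_with_partials5_def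
    by (intro has_derivative_continuous_on) blast
qed (use assms in \<open>simp_all add: C1_with_partials5_def\<close>)

lemma C1_with_partials4_continuous:
  assumes "C1_with_partials4 F Ft Fx Fv Fw"
  shows "continuous_on UNIV F" "continuous_on UNIV Fx" "continuous_on UNIV Fv" "continuous_on UNIV Fw"
proof -
  show "continuous_on UNIV F"
    using assms unfolding C1_with_partials4_def
    by (intro has_derivative_continuous_on) blast
qed (use assms in \<open>simp_all add: C1_with_partials4_def\<close>)

lemma brace_continuous:
  assumes "x \<in> FF \<alpha> \<beta> a b"
  shows "continuous_on {a..b} (brace \<alpha> \<beta> a b x)"
  using FFD(2-4)[OF assms] unfolding brace_def[abs_def] by (intro continuous_intros)

lemma bracket_continuous:
  assumes x: "x \<in> FF \<alpha> \<beta> a b" and l: "continuous_on UNIV l"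
  shows "continuous_on {a..b} (bracket l \<alpha> \<beta> a b x)"
proof -
  have "continuous_on {a..b} (\<lambda>t. l (brace \<alpha> \<beta> a b x t))"
    by (rule continuous_on_compose2[OF l brace_continuous[OF x]]) simp
  then have "continuous_on {a..b} (zvar l \<alpha> \<beta> a b x)"
    unfolding zvar_def[abs_def] by (intro indefinite_integral_continuous_1 integrable_continuous_real)
  then show ?thesis
    using FFD(2-4)[OF x] unfolding bracket_def[abs_def] by (intro continuous_intros)
qed

theorem theorem10p11:
  fixes \<alpha> \<beta> a b :: real
    and L Lt Lx Lv Lw Lz :: "real \<times> real \<times> real \<times> real \<times> real \<Rightarrow> real"
    and l lt lx lv lw :: "real \<times> real \<times> real \<times> real \<Rightarrow> real"
    and x :: "real \<Rightarrow> real"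
  assumes alpha: "0 < \<alpha>" "\<alpha> < 1"
    and beta: "0 < \<beta>"
    and ab: "a < b"
    and L_C1: "C1_with_partials5 L Lt Lx Lv Lw Lz"
    and l_C1: "C1_with_partials4 l lt lx lv lw"
    and x_adm: "x \<in> FF \<alpha> \<beta> a b"
    and EL_exists: "\<forall>t\<in>{a..b}.
          rRL_kernel \<alpha> b (\<lambda>s. Lv (bracket l \<alpha> \<beta> a b x s)) differentiable (at t within {a..b}) \<and>
          rRL_kernel \<alpha> b (\<lambda>s. integral {s..b} (\<lambda>\<tau>. Lz (bracket l \<alpha> \<beta> a b x \<tau>))
                                * lv (brace \<alpha> \<beta> a b x s)) differentiable (at t within {a..b})"
    and EL: "\<forall>t\<in>{a..b}.
          Lx (bracket l \<alpha> \<beta> a b x t)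
          + rRL_der \<alpha> a b (\<lambda>s. Lv (bracket l \<alpha> \<beta> a b x s)) t
          + rRL_int \<beta> b (\<lambda>s. Lw (bracket l \<alpha> \<beta> a b x s)) t
          + integral {t..b} (\<lambda>\<tau>. Lz (bracket l \<alpha> \<beta> a b x \<tau>)) * lx (brace \<alpha> \<beta> a b x t)
          + rRL_der \<alpha> a b (\<lambda>s. integral {s..b} (\<lambda>\<tau>. Lz (bracket l \<alpha> \<beta> a b x \<tau>))
                                * lv (brace \<alpha> \<beta> a b x s)) t
          + rRL_int \<beta> b (\<lambda>s. integral {s..b} (\<lambda>\<tau>. Lz (bracket l \<alpha> \<beta> a b x \<tau>))
                                * lw (brace \<alpha> \<beta> a b x s)) t
          = 0"
    and NBC: "rRL_int (1 - \<alpha>) b (\<lambda>s. Lv (bracket l \<alpha> \<beta> a b x s)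
               + integral {s..b} (\<lambda>\<tau>. Lz (bracket l \<alpha> \<beta> a b x \<tau>)) * lv (brace \<alpha> \<beta> a b x s)) a = 0"
    and L_convex: "convex_L L Lx Lv Lw Lz"
    and cases: "(convex_l l lx lv lw \<and> (\<forall>t\<in>{a..b}. Lz (bracket l \<alpha> \<beta> a b x t) \<ge> 0)) \<or>
                (concave_l l lx lv lw \<and> (\<forall>t\<in>{a..b}. Lz (bracket l \<alpha> \<beta> a b x t) \<le> 0))"
  shows "\<forall>y\<in>FF \<alpha> \<beta> a b. JJ L l \<alpha> \<beta> a b x \<le> JJ L l \<alpha> \<beta> a b y"
proof
  fix y assume y: "y \<in> FF \<alpha> \<beta> a b"
  note Lc = C1_with_partials5_continuous[OF L_C1]
  note lc = C1_with_partials4_continuous[OF l_C1]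
  define X where "X = bracket l \<alpha> \<beta> a b x"
  define Y where "Y = bracket l \<alpha> \<beta> a b y"
  define p where "p = brace \<alpha> \<beta> a b x"
  define q where "q = brace \<alpha> \<beta> a b y"
  have Xc: "continuous_on {a..b} X" and Yc: "continuous_on {a..b} Y"
    and pc: "continuous_on {a..b} p" and qc: "continuous_on {a..b} q"
    unfolding X_def Y_def p_def q_def
    by (intro bracket_continuous brace_continuous x_adm y lc(1))+
  have cX: "continuous_on {a..b} (\<lambda>t. F (X t))" if "continuous_on UNIV F" for F :: "_ \<Rightarrow> real"
    by (rule continuous_on_compose2[OF that Xc]) simp
  have cp: "continuous_on {a..b} (\<lambda>t. F (p t))" if "continuous_on UNIV F" for F :: "_ \<Rightarrow> real"
    by (rule continuous_on_compose2[OF that pc]) simp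
  have cY: "continuous_on {a..b} (\<lambda>t. L (Y t))"
    by (rule continuous_on_compose2[OF Lc(1) Yc]) simp
  have cq: "continuous_on {a..b} (\<lambda>t. l (q t))"
    by (rule continuous_on_compose2[OF lc(1) qc]) simp
  define h where "h = (\<lambda>t. y t - x t)"
  define D where "D = (\<lambda>t. lCaputo \<alpha> a b y t - lCaputo \<alpha> a b x t)"
  define I where "I = (\<lambda>t. lRL_int \<beta> a y t - lRL_int \<beta> a x t)"
  have hDI: "continuous_on {a..b} h" "continuous_on {a..b} D" "continuous_on {a..b} I"
    unfolding h_def D_def I_def by (intro continuous_intros FFD[OF x_adm] FFD[OF y])+
  define \<zeta> where "\<zeta> = (\<lambda>t. Lz (X t))"
  define \<Lambda> where "\<Lambda> = (\<lambda>t. integral {t..b} \<zeta>)"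
  have \<zeta>: "continuous_on {a..b} \<zeta>" unfolding \<zeta>_def by (rule cX[OF Lc(5)])
  have \<Lambda>: "continuous_on {a..b} \<Lambda>"
    unfolding \<Lambda>_def by (rule indefinite_integral_continuous_1'[OF integrable_continuous_real[OF \<zeta>]])
  \<comment> \<open>\<open>m\<close> is the first-order change of \<open>l\<close> from
    \<open>x\<close> to \<open>y\<close>; \<open>n\<close> below is that of \<open>L\<close> in
    every slot except \<open>z\<close>.\<close>
  define m where "m = (\<lambda>t. lx (p t) * h t + lv (p t) * D t + lw (p t) * I t)"
  have m: "continuous_on {a..b} m"
    unfolding m_def by (intro continuous_intros cp lc hDI)
  define n where "n = (\<lambda>t. Lx (X t) * h t + Lv (X t) * D t + Lw (X t) * I t)"
  have n: "continuous_on {a..b} n"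
    unfolding n_def by (intro continuous_intros cX Lc hDI)

  obtain M where M: "\<forall>t\<in>{a..b}. \<bar>\<zeta> t\<bar> \<le> M"
    using continuous_on_Icc_bounded[OF \<zeta>] by (elim exE)
  \<comment> \<open>Swapping the order of integration moves the accumulated change of
    \<open>l\<close> onto the weight \<open>\<Lambda>\<close>, the form in which the Euler-Lagrange
    equation contains it.\<close>
  obtain S where S: "((\<lambda>t. \<zeta> t * integral {a..t} m) has_integral S) {a..b}"
    "((\<lambda>t. m t * \<Lambda> t) has_integral S) {a..b}"
    unfolding \<Lambda>_def
    using integral_triangle_swap[where P = \<zeta> and u = m,
        OF absolutely_integrable_continuous_real[OF m]
          absolutely_integrable_continuous_real[OF \<zeta>] M[rule_format]] by metis

  \<comment> \<open>The parts from \<open>L\<close> and from \<open>l\<close> stay separate in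
    \<open>P1\<close>, \<open>P2\<close> and \<open>Q1\<close>, \<open>Q2\<close>, because
    \<open>EL_exists\<close> and \<open>EL\<close> treat them separately; they are joined in
    \<open>K\<close>.\<close>
  define A where "A = (\<lambda>t. Lx (X t) + \<Lambda> t * lx (p t))"
  define P1 where "P1 = (\<lambda>t. Lv (X t))"
  define P2 where "P2 = (\<lambda>t. \<Lambda> t * lv (p t))"
  define Q1 where "Q1 = (\<lambda>t. Lw (X t))"
  define Q2 where "Q2 = (\<lambda>t. \<Lambda> t * lw (p t))"
  have AP: "continuous_on {a..b} A" "continuous_on {a..b} P1" "continuous_on {a..b} P2"
    "continuous_on {a..b} Q1" "continuous_on {a..b} Q2"
    unfolding A_def P1_def P2_def Q1_def Q2_def by (intro continuous_intros cX cp Lc lc \<Lambda>)+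
  have diff: "rRL_int (1 - \<alpha>) b P1 differentiable (at t within {a..b})"
    "rRL_int (1 - \<alpha>) b P2 differentiable (at t within {a..b})" if "t \<in> {a..b}" for t
    using EL_exists[rule_format, OF that]
    by (simp_all add: P1_def P2_def X_def p_def \<Lambda>_def \<zeta>_def rRL_kernel_eq_rRL_int)
  have EL': "A t + rRL_der \<alpha> a b P1 t + rRL_der \<alpha> a b P2 t + rRL_int \<beta> b Q1 t + rRL_int \<beta> b Q2 t = 0"
    if "t \<in> {a..b}" for t
    using EL[rule_format, OF that]
    by (simp add: A_def P1_def P2_def Q1_def Q2_def X_def p_def \<Lambda>_def \<zeta>_def)
  have K: "(rRL_int (1 - \<alpha>) b (\<lambda>s. P1 s + P2 s) has_vector_derivative
      A t + rRL_int \<beta> b (\<lambda>s. Q1 s + Q2 s) t) (at t within {a..b})" if t: "t \<in> {a..b}" for t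
  proof -
    have "((\<lambda>s. rRL_int (1 - \<alpha>) b P1 s + rRL_int (1 - \<alpha>) b P2 s) has_vector_derivative
        (- rRL_der \<alpha> a b P1 t) + (- rRL_der \<alpha> a b P2 t)) (at t within {a..b})"
      using diff[OF t] unfolding rRL_der_def rRL_kernel_eq_rRL_int
      by (intro has_vector_derivative_add) (simp_all add: vector_derivative_works)
    moreover have "(- rRL_der \<alpha> a b P1 t) + (- rRL_der \<alpha> a b P2 t) =
        A t + rRL_int \<beta> b (\<lambda>s. Q1 s + Q2 s) t"
      using EL'[OF t] rRL_int_add[OF beta AP(4,5) t] by simp
    ultimately have der: "((\<lambda>s. rRL_int (1 - \<alpha>) b P1 s + rRL_int (1 - \<alpha>) b P2 s) has_vector_derivative
        A t + rRL_int \<beta> b (\<lambda>s. Q1 s + Q2 s) t) (at t within {a..b})" by simp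
    \<comment> \<open>The fractional integral of the sum is split pointwise on
      \<open>{a..b}\<close>, which suffices for a derivative within that interval.\<close>
    show ?thesis
      by (rule has_vector_derivative_transform[OF t _ der]) (use rRL_int_add[OF _ AP(2,3)] alpha in simp)
  qed
  have Ka: "rRL_int (1 - \<alpha>) b (\<lambda>s. P1 s + P2 s) a = 0"
    using NBC by (simp add: P1_def P2_def X_def p_def \<Lambda>_def \<zeta>_def)
  have "((\<lambda>t. A t * h t + (P1 t + P2 t) * D t + (Q1 t + Q2 t) * I t) has_integral 0) {a..b}"
    unfolding h_def D_def I_def
    by (rule first_variation_has_integral_zero[OF alpha beta less_imp_le[OF ab] x_adm y AP(1) _ _ K Ka])
      (intro continuous_intros AP)+
  then have "((\<lambda>t. n t + m t * \<Lambda> t) has_integral 0) {a..b}"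
    by (rule has_integral_eq[rotated])
      (simp add: n_def m_def A_def P1_def P2_def Q1_def Q2_def algebra_simps)
  \<comment> \<open>\<open>S\<close> is subtracted as the integral of \<open>m * \<Lambda>\<close>
    and then added back as the integral of \<open>\<zeta>\<close> times the primitive of
    \<open>m\<close>, which is the form that convexity produces.\<close>
  then have "(n has_integral - S) {a..b}"
    using has_integral_diff[OF _ S(2)] by fastforce
  then have total: "((\<lambda>t. n t + \<zeta> t * integral {a..t} m) has_integral 0) {a..b}"
    using has_integral_add[OF _ S(1)] by fastforce

  \<comment> \<open>Convexity of \<open>L\<close> gives a bound with the true change
    \<open>w\<close> of the \<open>z\<close> slot; this is then replaced by the linearized change,
    the integral of \<open>m\<close>.\<close>
  have le: "n t + \<zeta> t * integral {a..t} m \<le> L (Y t) - L (X t)" if t: "t \<in> {a..b}" for t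
  proof -
    define w where "w = zvar l \<alpha> \<beta> a b y t - zvar l \<alpha> \<beta> a b x t"
    have "L (t, x t + h t, lCaputo \<alpha> a b x t + D t, lRL_int \<beta> a x t + I t, zvar l \<alpha> \<beta> a b x t + w)
        - L (X t) \<ge> Lx (X t) * h t + Lv (X t) * D t + Lw (X t) * I t + Lz (X t) * w"
      using L_convex unfolding convex_L_def X_def bracket_def by blast
    then have L: "n t + \<zeta> t * w \<le> L (Y t) - L (X t)"
      by (simp add: n_def \<zeta>_def Y_def bracket_def h_def D_def I_def w_def)
    have sub: "{a..t} \<subseteq> {a..b}" using t by auto
    have int: "m integrable_on {a..t}" "(\<lambda>s. l (q s) - l (p s)) integrable_on {a..t}"
      by (intro integrable_continuous_real continuous_on_subset[OF _ sub] m continuous_intros cq cp lc(1))+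
    have w: "w = integral {a..t} (\<lambda>s. l (q s) - l (p s))"
      unfolding w_def zvar_def q_def[symmetric] p_def[symmetric]
      by (intro integral_diff[symmetric] integrable_continuous_real continuous_on_subset[OF _ sub] cq cp lc(1))
    have q: "q s = (s, x s + h s, lCaputo \<alpha> a b x s + D s, lRL_int \<beta> a x s + I s)" for s
      by (simp add: q_def brace_def h_def D_def I_def)
    have p: "p s = (s, x s, lCaputo \<alpha> a b x s, lRL_int \<beta> a x s)" for s
      by (simp add: p_def brace_def)
    \<comment> \<open>For convex \<open>l\<close> the change \<open>w\<close> is at least the
      linearized one and \<open>\<zeta>\<close> is nonnegative; for concave \<open>l\<close> both
      signs flip, so the products compare in the same direction.\<close>
    from cases have "\<zeta> t * integral {a..t} m \<le> \<zeta> t * w"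
    proof (elim disjE conjE)
      assume "convex_l l lx lv lw" and "\<forall>t\<in>{a..b}. Lz (bracket l \<alpha> \<beta> a b x t) \<ge> 0"
      moreover from this have "m s \<le> l (q s) - l (p s)" for s
        unfolding m_def q p convex_l_def by blast
      then have "integral {a..t} m \<le> w" unfolding w by (intro integral_le int)
      ultimately show ?thesis using t by (auto simp: \<zeta>_def X_def intro: mult_left_mono)
    next
      assume "concave_l l lx lv lw" and "\<forall>t\<in>{a..b}. Lz (bracket l \<alpha> \<beta> a b x t) \<le> 0"
      moreover from this have "l (q s) - l (p s) \<le> m s" for s
        unfolding m_def q p concave_l_def by blast
      then have "w \<le> integral {a..t} m" unfolding w by (intro integral_le int)
      ultimately show ?thesis using t by (auto simp: \<zeta>_def X_def intro: mult_left_mono_neg)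
    qed
    with L show ?thesis by simp
  qed
  have "((\<lambda>t. L (Y t) - L (X t)) has_integral JJ L l \<alpha> \<beta> a b y - JJ L l \<alpha> \<beta> a b x) {a..b}"
    unfolding JJ_def X_def[symmetric] Y_def[symmetric]
    by (intro has_integral_diff integrable_integral integrable_continuous_real cY cX Lc(1))
  from has_integral_le[OF total this le] show "JJ L l \<alpha> \<beta> a b x \<le> JJ L l \<alpha> \<beta> a b y" by simp
qed

end
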